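(* Let $\Gamma$ be a free group with free generating set $\mathcal A=\{a_1,\dots,a_p\}$, $p\ge 2$, let $\mathfrak C$ be a non-trivial conjugacy class in $\Gamma$, let $k=\min\{|x| : x\in\mathfrak C\}$ and $\mathfrak C_n=\{x\in\mathfrak C : |x|=n\}$. Suppose that $F:\Gamma\to\mathbb R$ satisfies: (A1) there exists a Hölder continuous function $f:\Sigma^*\to\mathbb R$ such that $F(x)=f^n(x)$ for each $x\in\Gamma_n$ and each $n\ge 0$; (A2) $F(x)=F(x^{-1})$ for all $x\in\Gamma$; (A3) $F(\cdot)-\overline F\,|\cdot|$ is unbounded as a function from $\Gamma$ to $\mathbb R$, where $\overline F=\int f\,d\mu_0$. Then the sequence (indexed by $m$) of functions of $a\in\mathbb R$ $$\frac{1}{\#\mathfrak C_{k+2m}}\#\left\{x\in\mathfrak C_{k+2m} : \frac{F(x)-(k+2m)\overline F}{\sqrt{k+2m}}\le a\right\}$$ converges, as $m\to\infty$, to the distribution function of a normal random variable with mean $0$ and positive variance $2\sigma_f^2$, where $$\sigma_f^2=\lim_{n\to\infty}\frac1n\int\left(f^n(x)-n\int f\,d\mu_0\right)^2 d\mu_0 .$$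
   Context: $|x|$ denotes the word length of $x\in\Gamma$ with respect to $\mathcal A$ (the length of the reduced word representing $x$, with $|1|=0$), and $\Gamma_n=\{x\in\Gamma : |x|=n\}$. The set $\mathfrak C_n$ is non-empty if and only if $n=k+2m$ for some integer $m\ge0$. $\Sigma$ is the space of infinite reduced words, i.e. sequences $(x_n)_{n\ge 0}$ in $\mathcal A\cup\mathcal A^{-1}$ with $x_{n+1}\ne x_n^{-1}$ for all $n\ge0$. $\Sigma^*=\Sigma\cup\Gamma$, where elements of $\Gamma$ are identified with finite reduced words (a finite word is regarded as an infinite sequence ending in an infinite string of the empty symbol $1$). The shift $\sigma:\Sigma^*\to\Sigma^*$ deletes the first letter: $(\sigma x)_n=x_{n+1}$, with $\sigma 1=1$. Fix $0<\theta<1$; the metric on $\Sigma^*$ is $d_\theta(x,x)=0$ and $d_\theta(x,y)=\theta^{\min\{n\ge0 : x_n\neq y_n\}}$ for $x\ne y$; Hölder continuity is with respect to $d_\theta$. The Birkhoff sums are $f^n(x)=f(x)+f(\sigma x)+\cdots+f(\sigma^{n-1}x)$ (with $f^0=0$). $\mu_0$ is the measure of maximal entropy of $\sigma:\Sigma\to\Sigma$: the $\sigma$-invariant Borel probability measure on $\Sigma$ giving, for each reduced word $w=w_0\cdots w_{n-1}$ of length $n\ge 1$, mass $(2p)^{-1}(2p-1)^{-(n-1)}$ to the cylinder $\{(x_j)_{j\ge0} : x_j=w_j,\ 0\le j\le n-1\}$. The limit defining $\sigma_f^2$ is known to exist. *)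

theory Defs
  imports "HOL-Algebra.Group" "HOL-Probability.Probability"
begin

text \<open>
  The free group on the generating set \<open>'a\<close>, as the group of reduced words: the letter
  \<open>(a, True)\<close> stands for the generator \<open>a\<close> and \<open>(a, False)\<close> for its inverse.
\<close>

type_synonym 'a letter = "'a \<times> bool"

definition letter_inv :: "'a letter \<Rightarrow> 'a letter" where
  "letter_inv l = (fst l, \<not> snd l)"

definition reduced_word :: "'a letter list \<Rightarrow> bool" where
  "reduced_word w \<longleftrightarrow> successively (\<lambda>a b. b \<noteq> letter_inv a) w"

text \<open>Left multiplication of a reduced word by one letter, with cancellation.\<close>

fun letter_mult :: "'a letter \<Rightarrow> 'a letter list \<Rightarrow> 'a letter list" where
  "letter_mult l [] = [l]"
| "letter_mult l (b # w) = (if b = letter_inv l then w else l # b # w)"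

definition free_group :: "'a letter list monoid" where
  "free_group = \<lparr>carrier = {w. reduced_word w}, monoid.mult = foldr letter_mult, one = []\<rparr>"

lemma letter_inv_letter_inv [simp]: "letter_inv (letter_inv l) = l"
  by (simp add: letter_inv_def)

lemma letter_inv_neq [simp]: "letter_inv l \<noteq> l" "l \<noteq> letter_inv l"
  by (simp_all add: letter_inv_def prod_eq_iff)

lemma reduced_simps [simp]:
  "reduced_word []" "reduced_word [l]"
  "reduced_word (l # b # w) \<longleftrightarrow> b \<noteq> letter_inv l \<and> reduced_word (b # w)"
  by (simp_all add: reduced_word_def)

lemma reduced_ConsD: "reduced_word (l # w) \<Longrightarrow> reduced_word w"
  by (cases w) simp_all

lemma reduced_letter_mult: "reduced_word w \<Longrightarrow> reduced_word (letter_mult l w)"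
  by (cases w) (auto dest: reduced_ConsD)

lemma letter_mult_reduced: "reduced_word (l # w) \<Longrightarrow> letter_mult l w = l # w"
  by (cases w) auto

lemma letter_mult_cancel: "reduced_word w \<Longrightarrow> letter_mult (letter_inv l) (letter_mult l w) = w"
proof (cases w)
  case (Cons b v)
  assume "reduced_word w"
  then show ?thesis
    using Cons letter_mult_reduced[of b v] by (cases v) auto
qed simp

lemma letter_mult_cancel': "reduced_word w \<Longrightarrow> letter_mult l (letter_mult (letter_inv l) w) = w"
  using letter_mult_cancel[of w "letter_inv l"] by simp

lemma reduced_foldr: "reduced_word y \<Longrightarrow> reduced_word (foldr letter_mult x y)"
  by (induction x) (auto intro: reduced_letter_mult)

lemma foldr_letter_mult:
  assumes "reduced_word z"
  shows "foldr letter_mult (letter_mult l w) z = letter_mult l (foldr letter_mult w z)"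
  using assms by (cases w) (auto simp: letter_mult_cancel' reduced_foldr)

lemma foldr_letter_mult_Nil: "reduced_word x \<Longrightarrow> foldr letter_mult x [] = x"
proof (induction x)
  case (Cons l x)
  then have "foldr letter_mult x [] = x"
    by (blast dest: reduced_ConsD)
  then show ?case
    using Cons.prems by (simp add: letter_mult_reduced)
qed simp

lemma free_group_simps [simp]:
  "w \<in> carrier free_group \<longleftrightarrow> reduced_word w"
  "x \<otimes>\<^bsub>free_group\<^esub> y = foldr letter_mult x y"
  "\<one>\<^bsub>free_group\<^esub> = []"
  by (simp_all add: free_group_def)

theorem group_free_group: "group free_group"
proof (rule groupI)
  fix x y z :: "'a letter list"
  assume "x \<in> carrier free_group" "y \<in> carrier free_group" "z \<in> carrier free_group"
  then have z: "reduced_word z"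
    by simp
  have "foldr letter_mult (foldr letter_mult x y) z = foldr letter_mult x (foldr letter_mult y z)"
    by (induction x) (simp_all add: foldr_letter_mult[OF z])
  then show "x \<otimes>\<^bsub>free_group\<^esub> y \<otimes>\<^bsub>free_group\<^esub> z = x \<otimes>\<^bsub>free_group\<^esub> (y \<otimes>\<^bsub>free_group\<^esub> z)"
    by simp
next
  fix x :: "'a letter list"
  assume "x \<in> carrier free_group"
  then have x: "reduced_word x"
    by simp
  have *: "foldr letter_mult (foldr letter_mult u []) v = foldr letter_mult u v"
    if "reduced_word v" for u v :: "'a letter list"
    by (induction u) (simp_all add: foldr_letter_mult[OF that])
  have "foldr letter_mult (rev (map letter_inv x)) x = []"
    using x
  proof (induction x)
    case (Cons l x)
    then have "reduced_word x"
      by (blast dest: reduced_ConsD)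
    then show ?case
      using Cons.IH by simp
  qed simp
  with *[OF x] show "\<exists>y\<in>carrier free_group. y \<otimes>\<^bsub>free_group\<^esub> x = \<one>\<^bsub>free_group\<^esub>"
    by (intro bexI[of _ "foldr letter_mult (rev (map letter_inv x)) []"]) (simp_all add: reduced_foldr)
qed (simp_all add: reduced_foldr)

text \<open>The universal property: the one-letter words \<open>[(a, True)]\<close> generate the group freely.\<close>

theorem free_group_universal:
  fixes h :: "'a \<Rightarrow> 'b" and G :: "('b, 'c) monoid_scheme"
    and \<phi> \<psi> :: "'a letter list \<Rightarrow> 'b"
  assumes "group G" "\<And>a. h a \<in> carrier G"
  shows "\<exists>\<xi>\<in>hom free_group G. \<forall>a. \<xi> [(a, True)] = h a"
    and "\<lbrakk>\<phi> \<in> hom free_group G; \<psi> \<in> hom free_group G; \<forall>a. \<phi> [(a, True)] = \<psi> [(a, True)];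
          x \<in> carrier free_group\<rbrakk> \<Longrightarrow> \<phi> x = \<psi> x"
proof -
  interpret G: group G by fact
  interpret F: group "free_group :: 'a letter list monoid" by (rule group_free_group)
  define g where "g l = (if snd l then h (fst l) else inv\<^bsub>G\<^esub> h (fst l))" for l
  have g: "g l \<in> carrier G" for l
    using assms(2) by (simp add: g_def)
  have g_inv: "g (letter_inv l) = inv\<^bsub>G\<^esub> g l" for l
    using assms(2) by (simp add: g_def letter_inv_def)
  define ph where "ph w = foldr (\<lambda>l y. g l \<otimes>\<^bsub>G\<^esub> y) w \<one>\<^bsub>G\<^esub>" for w
  have ph: "ph [] = \<one>\<^bsub>G\<^esub>" "ph (l # w) = g l \<otimes>\<^bsub>G\<^esub> ph w" for l w
    by (simp_all add: ph_def)
  have ph_c: "ph w \<in> carrier G" for w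
    by (induction w) (simp_all add: ph g)
  have ph_l: "ph (letter_mult l w) = g l \<otimes>\<^bsub>G\<^esub> ph w" for l w
    by (cases w) (auto simp: ph g ph_c g_inv G.m_assoc[symmetric])
  have ph_m: "ph (foldr letter_mult x y) = ph x \<otimes>\<^bsub>G\<^esub> ph y" for x y
    by (induction x) (simp_all add: ph ph_l g ph_c G.m_assoc)
  have "ph \<in> hom free_group G"
    by (auto simp: hom_def ph_c ph_m)
  moreover have "ph [(a, True)] = h a" for a
    using assms(2) by (simp add: ph g_def)
  ultimately show "\<exists>\<xi>\<in>hom free_group G. \<forall>a. \<xi> [(a, True)] = h a"
    by blast
  assume hom: "\<phi> \<in> hom free_group G" "\<psi> \<in> hom free_group G"
    and eq: "\<forall>a. \<phi> [(a, True)] = \<psi> [(a, True)]" and x: "x \<in> carrier free_group"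
  interpret P: group_hom free_group G \<phi> by (intro group_hom.intro group_hom_axioms.intro group_free_group assms hom)
  interpret S: group_hom free_group G \<psi> by (intro group_hom.intro group_hom_axioms.intro group_free_group assms hom)
  have inv: "inv\<^bsub>free_group\<^esub> [(a, True)] = [(a, False)]" for a :: 'a
    by (rule F.inv_equality) (simp_all add: letter_inv_def)
  have inv_mem: "[(a, True)] \<in> carrier free_group" for a :: 'a
    by simp
  have "\<phi> [(a, False)] = \<psi> [(a, False)]" for a
    using P.hom_inv[OF inv_mem] S.hom_inv[OF inv_mem] eq unfolding inv by metis
  then have l: "\<phi> [l] = \<psi> [l]" for l
    using eq by (metis (full_types) prod.exhaust)
  have "reduced_word x" using x by simp
  then show "\<phi> x = \<psi> x"
  proof (induction x)
    case (Cons a x)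
    then have r: "reduced_word x" by (blast dest: reduced_ConsD)
    have "a # x = [a] \<otimes>\<^bsub>free_group\<^esub> x"
      using Cons by (simp add: letter_mult_reduced)
    then show ?case
      using r Cons l P.hom_mult[of "[a]" x] S.hom_mult[of "[a]" x] by (metis free_group_simps(1) reduced_simps(2))
  qed (use P.hom_one S.hom_one in simp)
qed

definition conjugacy_classes :: "('g, 'b) monoid_scheme \<Rightarrow> 'g set set" where
  "conjugacy_classes G =
     (\<lambda>x. {g \<otimes>\<^bsub>G\<^esub> x \<otimes>\<^bsub>G\<^esub> inv\<^bsub>G\<^esub> g | g. g \<in> carrier G}) ` carrier G"

definition of_length :: "'a letter list set \<Rightarrow> nat \<Rightarrow> 'a letter list set" where
  "of_length X n = {x \<in> X. length x = n}"

definition min_length :: "'a letter list set \<Rightarrow> nat" where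
  "min_length X = (INF x\<in>X. length x)"

text \<open>
  Infinite sequences of letters, where \<open>None\<close> is the empty symbol; \<open>word_seq\<close> pads a finite word
  with empty symbols.
\<close>

type_synonym 'a letter_seq = "nat \<Rightarrow> 'a letter option"

definition word_seq :: "'a letter list \<Rightarrow> 'a letter_seq" where
  "word_seq w n = (if n < length w then Some (w ! n) else None)"

definition inf_words :: "'a letter_seq set" where
  "inf_words = {\<lambda>n. Some (y n) | y. \<forall>n. y (Suc n) \<noteq> letter_inv (y n)}"

definition all_words :: "'a letter_seq set" where
  "all_words = inf_words \<union> word_seq ` carrier free_group"

definition seq_shift :: "'a letter_seq \<Rightarrow> 'a letter_seq" where
  "seq_shift x n = x (Suc n)"

definition birkhoff_sum :: "('a letter_seq \<Rightarrow> real) \<Rightarrow> nat \<Rightarrow> 'a letter_seq \<Rightarrow> real" where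
  "birkhoff_sum f n x = (\<Sum>j<n. f ((seq_shift ^^ j) x))"

definition d_theta :: "real \<Rightarrow> 'a letter_seq \<Rightarrow> 'a letter_seq \<Rightarrow> real" where
  "d_theta \<theta> x y = (if x = y then 0 else \<theta> ^ (LEAST n. x n \<noteq> y n))"

definition hoelder_on :: "'b set \<Rightarrow> ('b \<Rightarrow> 'b \<Rightarrow> real) \<Rightarrow> ('b \<Rightarrow> real) \<Rightarrow> bool" where
  "hoelder_on S d f \<longleftrightarrow>
     (\<exists>\<alpha> C. 0 < \<alpha> \<and> \<alpha> \<le> 1 \<and> (\<forall>x\<in>S. \<forall>y\<in>S. \<bar>f x - f y\<bar> \<le> C * d x y powr \<alpha>))"

lemma Metric_space_d_theta:
  assumes "0 < \<theta>" "\<theta> < 1"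
  shows "Metric_space S (d_theta \<theta>)"
proof
  fix x y z :: "'a letter_seq"
  show "0 \<le> d_theta \<theta> x y"
    using assms by (simp add: d_theta_def)
  show "d_theta \<theta> x y = d_theta \<theta> y x"
    unfolding d_theta_def by (simp add: eq_commute)
  show "d_theta \<theta> x y = 0 \<longleftrightarrow> x = y"
    using assms by (simp add: d_theta_def)
  show "d_theta \<theta> x z \<le> d_theta \<theta> x y + d_theta \<theta> y z"
  proof (cases "x = y \<or> y = z \<or> x = z")
    case True
    then show ?thesis
      using assms by (auto simp: d_theta_def)
  next
    case False
    define n where "n = (LEAST n. x n \<noteq> z n)"
    have "\<exists>n. x n \<noteq> z n"
      using False by blast
    then have "x n \<noteq> z n"
      unfolding n_def by (rule LeastI_ex)
    then consider "x n \<noteq> y n" | "y n \<noteq> z n"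
      by metis
    then have "\<theta> ^ n \<le> \<theta> ^ (LEAST n. x n \<noteq> y n) \<or> \<theta> ^ n \<le> \<theta> ^ (LEAST n. y n \<noteq> z n)"
    proof cases
      case 1
      then have "(LEAST n. x n \<noteq> y n) \<le> n"
        by (rule Least_le)
      then show ?thesis
        using assms by (intro disjI1 power_decreasing) simp_all
    next
      case 2
      then have "(LEAST n. y n \<noteq> z n) \<le> n"
        by (rule Least_le)
      then show ?thesis
        using assms by (intro disjI2 power_decreasing) simp_all
    qed
    moreover have "0 \<le> \<theta> ^ (LEAST n. x n \<noteq> y n)" "0 \<le> \<theta> ^ (LEAST n. y n \<noteq> z n)"
      using assms by simp_all
    ultimately have "\<theta> ^ n \<le> \<theta> ^ (LEAST n. x n \<noteq> y n) + \<theta> ^ (LEAST n. y n \<noteq> z n)"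
      by linarith
    then show ?thesis
      using False by (simp add: d_theta_def n_def)
  qed
qed

definition cylinder :: "'a letter list \<Rightarrow> 'a letter_seq set" where
  "cylinder w = {x \<in> inf_words. \<forall>j<length w. x j = Some (w ! j)}"

text \<open>
  The invariant measure giving mass \<open>1 / (2p (2p - 1) ^ (n - 1))\<close> to each cylinder of length
  \<open>n \<ge> 1\<close>, where \<open>p\<close> is the rank. It is unique, and it does not depend on \<open>\<theta>\<close>, which enters
  only through the topology of \<open>d_theta \<theta>\<close>.
\<close>

definition max_entropy_measure :: "real \<Rightarrow> 'a::finite letter_seq measure \<Rightarrow> bool" where
  "max_entropy_measure \<theta> \<mu> \<longleftrightarrow>
     space \<mu> = inf_words \<and>
     sets \<mu> = sigma_sets inf_words {U. openin (Metric_space.mtopology inf_words (d_theta \<theta>)) U} \<and>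
     prob_space \<mu> \<and>
     seq_shift \<in> measurable \<mu> \<mu> \<and> distr \<mu> \<mu> seq_shift = \<mu> \<and>
     (\<forall>w. w \<noteq> [] \<longrightarrow> reduced_word w \<longrightarrow>
        measure \<mu> (cylinder w) =
          1 / (2 * real CARD('a)) * (1 / (2 * real CARD('a) - 1)) ^ (length w - 1))"

definition variance_seq :: "'a letter_seq measure \<Rightarrow> ('a letter_seq \<Rightarrow> real) \<Rightarrow> nat \<Rightarrow> real" where
  "variance_seq \<mu> f n =
     1 / real n * (\<integral>x. (birkhoff_sum f n x - real n * (\<integral>y. f y \<partial>\<mu>))\<^sup>2 \<partial>\<mu>)"

text \<open>\<open>lim\<close> is meaningful only together with convergence of \<open>variance_seq \<mu> f\<close>.\<close>

definition asymptotic_variance :: "'a letter_seq measure \<Rightarrow> ('a letter_seq \<Rightarrow> real) \<Rightarrow> real" where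
  "asymptotic_variance \<mu> f = lim (variance_seq \<mu> f)"

text \<open>The second parameter is the variance.\<close>

definition normal_cdf :: "real \<Rightarrow> real \<Rightarrow> real \<Rightarrow> real" where
  "normal_cdf m v = cdf (density lborel (\<lambda>x. ennreal (normal_density m (sqrt v) x)))"

end

theory Submission
  imports Defs "HOL-Real_Asymp.Real_Asymp"
begin

text \<open>
  Every element of length \<open>k + 2m\<close> of the conjugacy class is, without cancellation, a product
  \<open>w\<inverse> g w\<close> with \<open>g\<close> one of the finitely many shortest elements of the class and \<open>|w| = m\<close>; the word
  \<open>w\<close> is arbitrary except that two first letters are forbidden (\<open>conjugacy_class_of_length\<close>). Since \<open>f\<close>
  is Hoelder continuous, the Birkhoff sum over such a product splits, up to a bounded error, into the
  contributions of \<open>w\<inverse>\<close> and of \<open>w\<close>, and these agree because \<open>F\<close> is invariant under inversion. Hence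
  \<open>F(w\<inverse> g w) = 2 F(w) + O(1)\<close>, and after division by \<open>sqrt (k + 2m)\<close> the assertion becomes a
  central limit theorem, with variance doubled, for \<open>F\<close> on a uniformly chosen reduced word of length \<open>m\<close>
  whose first letter lies in a prescribed set.

  That theorem is proved with the transfer operator \<open>L\<close> of the shift, which averages a function over the
  ways to put one more letter in front of an infinite reduced word. Two words with different first
  letters share all but one of their possible predecessors, so the oscillation of \<open>L\<^sup>n h\<close>
  decays exponentially for Hoelder \<open>h\<close> (\<open>transfer_pow_hoelder\<close>) and \<open>L\<^sup>n h\<close> tends uniformly to
  the integral of \<open>h\<close> for the measure of maximal entropy (\<open>transfer_pow_tends_to_mean\<close>). Summing
  the series of \<open>L\<^sup>n h\<close> solves the Poisson equation \<open>v - L v = h\<close> for \<open>h\<close> of mean zero, and yields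
  \<open>f - \<integral> f = \<xi> + u \<circ> \<sigma> - u\<close> with \<open>L \<xi> = 0\<close> (\<open>martingale_decomposition\<close>). Up to bounded terms
  the centred Birkhoff sums of \<open>f\<close> are thus those of \<open>\<xi>\<close>, whose terms are orthogonal: the variance
  limit exists and equals \<open>s = \<integral> \<xi>\<^sup>2\<close>. If \<open>s\<close> vanished, \<open>\<xi>\<close> would vanish identically and
  \<open>F - Fbar |\<cdot>|\<close> would be bounded.

  For the limit law, write \<open>L\<^sub>t h = L (exp (i t \<xi>) h)\<close>, so that \<open>L\<^sub>t\<^sup>n 1\<close> computes characteristic functions of the Birkhoff sums.
  If \<open>\<psi> - L \<psi> = L (\<xi>\<^sup>2) - s\<close>, then \<open>h\<^sub>t = 1 - t\<^sup>2 \<psi> / 2\<close> satisfies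
  \<open>L\<^sub>t h\<^sub>t = exp (- s t\<^sup>2 / 2) h\<^sub>t + O(|t|\<^sup>3)\<close> in the supremum norm. As \<open>L\<^sub>t\<close> is a
  contraction, \<open>n\<close> iterations with \<open>t\<close> of order \<open>1 / sqrt n\<close> accumulate an error of order \<open>1 / sqrt n\<close>
  only (\<open>twisted_transfer_pow_estimate\<close>). The restriction on the first letter is asymptotically
  independent of the rest of the word and merely multiplies by a constant (\<open>transfer_clt\<close>), and Levy's
  continuity theorem turns the convergence of characteristic functions into that of distribution
  functions.
\<close>

section \<open>Infinite reduced words\<close>

definition scons :: "'a letter \<Rightarrow> 'a letter_seq \<Rightarrow> 'a letter_seq" where
  "scons l x = case_nat (Some l) x"

lemma scons_simps [simp]: "scons l x 0 = Some l" "scons l x (Suc n) = x n"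
  by (simp_all add: scons_def)

lemma seq_shift_scons [simp]: "seq_shift (scons l x) = x"
  by (simp add: seq_shift_def fun_eq_iff)

lemma inf_words_iff:
  "x \<in> inf_words \<longleftrightarrow> (\<forall>n. \<exists>a b. x n = Some a \<and> x (Suc n) = Some b \<and> b \<noteq> letter_inv a)"
proof
  assume R: "\<forall>n. \<exists>a b. x n = Some a \<and> x (Suc n) = Some b \<and> b \<noteq> letter_inv a"
  then have 1: "x = (\<lambda>n. Some (the (x n)))"
    by (metis option.sel)
  have 2: "\<forall>n. the (x (Suc n)) \<noteq> letter_inv (the (x n))"
    using R by (metis option.sel)
  show "x \<in> inf_words"
    unfolding inf_words_def mem_Collect_eq by (rule exI, rule conjI, rule 1, rule 2)
qed (auto simp: inf_words_def simp del: split_paired_Ex)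

lemma inf_words_Some: "x \<in> inf_words \<Longrightarrow> x n = Some (the (x n))"
  unfolding inf_words_iff by (metis option.sel)

lemma inf_words_step: "x \<in> inf_words \<Longrightarrow> the (x (Suc n)) \<noteq> letter_inv (the (x n))"
  unfolding inf_words_iff by (metis option.sel)

lemma seq_shift_inf_words [intro]: "x \<in> inf_words \<Longrightarrow> seq_shift x \<in> inf_words"
  by (auto simp: inf_words_iff seq_shift_def)

lemma constant_word_inf_words [simp]: "(\<lambda>_. Some c) \<in> inf_words"
  by (simp add: inf_words_iff)

definition preceding :: "'a letter_seq \<Rightarrow> 'a letter set" where
  "preceding x = {l. x 0 \<noteq> Some (letter_inv l)}"

lemma scons_inf_words:
  assumes "x \<in> inf_words" "l \<in> preceding x"
  shows "scons l x \<in> inf_words"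
  unfolding inf_words_iff
proof
  fix n
  obtain a b where "x 0 = Some a" "b \<in> {a}"
    using inf_words_Some[OF assms(1), of 0] by blast
  then show "\<exists>a b. scons l x n = Some a \<and> scons l x (Suc n) = Some b \<and> b \<noteq> letter_inv a"
    using assms by (cases n) (auto simp: preceding_def inf_words_iff)
qed

lemma preceding_eq:
  assumes "x \<in> inf_words"
  shows "preceding x = UNIV - {letter_inv (the (x 0))}"
proof -
  obtain a where "x 0 = Some a"
    using inf_words_Some[OF assms] by blast
  then show ?thesis
    by (auto simp: preceding_def)
qed

text \<open>
  The number of letters that may precede a given letter; as a real number it is the normalising factor
  of the transfer operator.
\<close>

definition branching :: "'a::finite itself \<Rightarrow> real" where
  "branching _ = 2 * real CARD('a) - 1"

lemma branching_pos: "branching TYPE('a::finite) > 0"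
proof -
  have "CARD('a) \<ge> 1" by (simp add: Suc_leI)
  then show ?thesis unfolding branching_def by linarith
qed

lemma card_preceding:
  fixes x :: "'a::finite letter_seq"
  assumes "x \<in> inf_words"
  shows "real (card (preceding x)) = branching TYPE('a)"
proof -
  have "CARD('a) \<ge> 1" by (simp add: Suc_leI)
  then show ?thesis
    by (simp add: preceding_eq[OF assms] card_Diff_subset branching_def of_nat_diff)
qed

section \<open>The transfer operator\<close>

text \<open>
  The Ruelle operator of the shift for a constant potential, normalised to fix the constants. Real
  values are used for mean values and the Poisson equation, complex values for characteristic functions.
\<close>

definition transfer :: "('a::finite letter_seq \<Rightarrow> 'b::real_vector) \<Rightarrow> 'a letter_seq \<Rightarrow> 'b" where
  "transfer h x = (1 / branching TYPE('a)) *\<^sub>R (\<Sum>l\<in>preceding x. h (scons l x))"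

lemma transfer_cong:
  assumes "x \<in> inf_words" "\<And>y. y \<in> inf_words \<Longrightarrow> h y = h' y"
  shows "transfer h x = transfer h' x"
  unfolding transfer_def by (simp add: assms scons_inf_words cong: sum.cong)

lemma transfer_pow_cong:
  assumes "x \<in> inf_words" "\<And>y. y \<in> inf_words \<Longrightarrow> h y = h' y"
  shows "(transfer ^^ n) h x = (transfer ^^ n) h' x"
  using assms by (induction n arbitrary: x) (auto intro: transfer_cong)

lemma transfer_const:
  fixes x :: "'a::finite letter_seq"
  assumes "x \<in> inf_words"
  shows "transfer (\<lambda>_. c) x = c"
  using card_preceding[OF assms] branching_pos[where 'a='a]
  by (simp add: transfer_def sum_constant_scaleR)

lemma transfer_pow_const: "x \<in> inf_words \<Longrightarrow> (transfer ^^ n) (\<lambda>_. c) x = c"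
proof (induction n arbitrary: x)
  case (Suc n)
  have "(transfer ^^ Suc n) (\<lambda>_. c) x = transfer (\<lambda>_. c) x"
    using Suc by (auto intro!: transfer_cong)
  then show ?case using transfer_const Suc.prems by metis
qed simp

lemma transfer_add: "transfer (\<lambda>x. h x + h' x) x = transfer h x + transfer h' x"
  by (simp add: transfer_def sum.distrib scaleR_add_right)

lemma transfer_diff: "transfer (\<lambda>x. h x - h' x) x = transfer h x - transfer h' x"
  by (simp add: transfer_def sum_subtractf scaleR_diff_right)

lemma transfer_mult_left:
  "transfer (\<lambda>x. c * h x) x = c * transfer h x" for c :: "'b::real_algebra"
  by (simp add: transfer_def sum_distrib_left)

lemma transfer_pow_add:
  "(transfer ^^ n) (\<lambda>x. h x + h' x) x = (transfer ^^ n) h x + (transfer ^^ n) h' x"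
proof (induction n arbitrary: x)
  case (Suc n)
  have "(transfer ^^ n) (\<lambda>x. h x + h' x) = (\<lambda>x. (transfer ^^ n) h x + (transfer ^^ n) h' x)"
    by (rule ext) (rule Suc.IH)
  then show ?case by (simp add: transfer_add)
qed simp

lemma transfer_pow_diff:
  "(transfer ^^ n) (\<lambda>x. h x - h' x) x = (transfer ^^ n) h x - (transfer ^^ n) h' x"
proof (induction n arbitrary: x)
  case (Suc n)
  have "(transfer ^^ n) (\<lambda>x. h x - h' x) = (\<lambda>x. (transfer ^^ n) h x - (transfer ^^ n) h' x)"
    by (rule ext) (rule Suc.IH)
  then show ?case by (simp add: transfer_diff)
qed simp

lemma transfer_pow_mult_left:
  "(transfer ^^ n) (\<lambda>x. c * h x) x = c * (transfer ^^ n) h x" for c :: "'b::real_algebra"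
proof (induction n arbitrary: x)
  case (Suc n)
  have "(transfer ^^ n) (\<lambda>x. c * h x) = (\<lambda>x. c * (transfer ^^ n) h x)"
    by (rule ext) (rule Suc.IH)
  then show ?case by (simp add: transfer_mult_left)
qed simp

lemma norm_transfer_le:
  fixes h :: "'a::finite letter_seq \<Rightarrow> 'b::real_normed_vector"
  assumes "x \<in> inf_words" "\<And>l. l \<in> preceding x \<Longrightarrow> norm (h (scons l x)) \<le> c"
  shows "norm (transfer h x) \<le> c"
proof -
  have "norm (\<Sum>l\<in>preceding x. h (scons l x)) \<le> real (card (preceding x)) * c"
    using assms(2) by (intro order.trans[OF norm_sum] sum_bounded_above) auto
  then show ?thesis
    using branching_pos[where 'a='a]
    by (simp add: transfer_def card_preceding[OF assms(1)] divide_simps mult.commute)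
qed

lemma norm_transfer_pow_le:
  fixes h :: "'a::finite letter_seq \<Rightarrow> 'b::real_normed_vector"
  assumes "x \<in> inf_words" "\<And>y. y \<in> inf_words \<Longrightarrow> norm (h y) \<le> c"
  shows "norm ((transfer ^^ n) h x) \<le> c"
  using assms(1)
  by (induction n arbitrary: x) (auto intro!: norm_transfer_le scons_inf_words assms(2))

lemma norm_transfer_pow_diff_le:
  fixes h h' :: "'a::finite letter_seq \<Rightarrow> 'b::real_normed_vector"
  assumes "x \<in> inf_words" "\<And>y. y \<in> inf_words \<Longrightarrow> norm (h y - h' y) \<le> c"
  shows "norm ((transfer ^^ n) h x - (transfer ^^ n) h' x) \<le> c"
  unfolding transfer_pow_diff[symmetric] by (rule norm_transfer_pow_le[OF assms])

text \<open>
  Functions of the shifted word can be pulled out of \<open>transfer\<close>, since it sums over the words with a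
  given shift. This makes \<open>transfer h = 0\<close> a martingale difference condition.
\<close>

lemma transfer_mult_shift:
  "transfer (\<lambda>y. g (seq_shift y) * h y) x = g x * transfer h x" for g :: "_ \<Rightarrow> 'b::real_algebra"
  by (simp add: transfer_def sum_distrib_left)

lemma transfer_shift: "x \<in> inf_words \<Longrightarrow> transfer (\<lambda>y. g (seq_shift y)) x = g x"
  using transfer_const[of x "g x"] by (simp add: transfer_def)

section \<open>Contraction of oscillations\<close>

text \<open>
  Hoelder continuity for \<open>d_theta \<theta>\<close>, with \<open>\<beta>\<close> in the place of \<open>\<theta> powr \<alpha>\<close>. The case \<open>N = 0\<close> bounds the
  oscillation on \<open>S\<close>, so this form includes boundedness.
\<close>

definition hoelder_with :: "real \<Rightarrow> real \<Rightarrow> 'a letter_seq set \<Rightarrow> ('a letter_seq \<Rightarrow> real) \<Rightarrow> bool" where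
  "hoelder_with K \<beta> S h \<longleftrightarrow>
     (\<forall>x\<in>S. \<forall>y\<in>S. \<forall>N. (\<forall>i<N. x i = y i) \<longrightarrow> \<bar>h x - h y\<bar> \<le> K * \<beta> ^ N)"

lemma hoelder_withD:
  "\<lbrakk>hoelder_with K \<beta> S h; x \<in> S; y \<in> S; \<And>i. i < N \<Longrightarrow> x i = y i\<rbrakk> \<Longrightarrow> \<bar>h x - h y\<bar> \<le> K * \<beta> ^ N"
  unfolding hoelder_with_def by blast

lemma hoelder_withI:
  "(\<And>x y N. \<lbrakk>x \<in> S; y \<in> S; \<And>i. i < N \<Longrightarrow> x i = y i\<rbrakk> \<Longrightarrow> \<bar>h x - h y\<bar> \<le> K * \<beta> ^ N)
    \<Longrightarrow> hoelder_with K \<beta> S h"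
  unfolding hoelder_with_def by blast

lemma hoelder_with_nonneg:
  assumes "hoelder_with K \<beta> inf_words h"
  shows "0 \<le> K"
  using hoelder_withD[OF assms constant_word_inf_words constant_word_inf_words, of 0 c c for c] by simp

text \<open>
  A coupling argument: the letters that may precede \<open>x\<close> are those that may precede \<open>y\<close>, except for one
  letter on each side. Common predecessors give words with equal first letter, and the one
  unmatched pair has weight \<open>1 / branching TYPE('a)\<close>.
\<close>

lemma transfer_osc_different_first:
  fixes h :: "'a::finite letter_seq \<Rightarrow> real"
  assumes x: "x \<in> inf_words" and y: "y \<in> inf_words" and ne: "x 0 \<noteq> y 0"
    and same: "\<And>u v. \<lbrakk>u \<in> inf_words; v \<in> inf_words; u 0 = v 0\<rbrakk> \<Longrightarrow> \<bar>h u - h v\<bar> \<le> P"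
    and osc: "\<And>u v. \<lbrakk>u \<in> inf_words; v \<in> inf_words\<rbrakk> \<Longrightarrow> \<bar>h u - h v\<bar> \<le> D"
  shows "\<bar>transfer h x - transfer h y\<bar> \<le> P + D / branching TYPE('a)"
proof -
  define q where "q = branching TYPE('a)"
  have q: "q > 0" using branching_pos[where 'a='a] by (simp add: q_def)
  define a b where "a = letter_inv (the (x 0))" and "b = letter_inv (the (y 0))"
  have ab: "a \<noteq> b"
    using ne inf_words_Some[OF x, of 0] inf_words_Some[OF y, of 0]
    by (metis a_def b_def letter_inv_letter_inv)
  have px: "preceding x = insert b (UNIV - {a, b})" and py: "preceding y = insert a (UNIV - {a, b})"
    using ab unfolding preceding_eq[OF x] preceding_eq[OF y] a_def[symmetric] b_def[symmetric] by blast+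
  have sx: "(\<Sum>l\<in>preceding x. h (scons l x)) = h (scons b x) + (\<Sum>l\<in>UNIV - {a, b}. h (scons l x))"
    and sy: "(\<Sum>l\<in>preceding y. h (scons l y)) = h (scons a y) + (\<Sum>l\<in>UNIV - {a, b}. h (scons l y))"
    unfolding px py by (subst sum.insert; simp)+
  \<comment> \<open>pair the exceptional predecessor \<open>b\<close> of \<open>x\<close> with the exceptional predecessor \<open>a\<close> of \<open>y\<close>\<close>
  have eq: "q * (transfer h x - transfer h y) = (h (scons b x) - h (scons a y))
      + (\<Sum>l\<in>UNIV - {a, b}. h (scons l x) - h (scons l y))"
    using q by (simp add: transfer_def sx sy sum_subtractf field_simps q_def)
  have 1: "\<bar>h (scons b x) - h (scons a y)\<bar> \<le> D"
    by (rule osc; rule scons_inf_words; use x y px py in simp)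
  have P: "0 \<le> P"
    using same[OF x x] by simp
  have "\<bar>\<Sum>l\<in>UNIV - {a, b}. h (scons l x) - h (scons l y)\<bar> \<le> card (UNIV - {a, b}) * P"
    by (intro order.trans[OF sum_abs] sum_bounded_above same scons_inf_words x y) (auto simp: px py)
  also have "\<dots> \<le> card (preceding x) * P"
    by (intro mult_right_mono of_nat_mono card_mono P) (auto simp: px)
  finally have 2: "\<bar>\<Sum>l\<in>UNIV - {a, b}. h (scons l x) - h (scons l y)\<bar> \<le> q * P"
    by (simp add: card_preceding[OF x] q_def)
  have "q * \<bar>transfer h x - transfer h y\<bar> = \<bar>q * (transfer h x - transfer h y)\<bar>"
    using q by (simp add: abs_mult)
  also have "\<dots> \<le> D + q * P"
    unfolding eq using 1 2 by linarith
  finally show ?thesis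
    using q by (simp add: q_def[symmetric] field_simps)
qed

text \<open>
  The spectral gap in elementary form. Words with equal first letter have the same predecessors, so their
  images under \<open>n\<close> steps differ by at most \<open>K * \<beta> ^ (n + N)\<close>. For different first letters the
  coupling gives the recursion \<open>D (n + 1) \<le> K * \<beta> ^ (n + 1) + D n / 3\<close> for the oscillation, and
  \<open>1 / 2 \<le> \<beta>\<close> makes \<open>D n \<le> 3 * K * \<beta> ^ n\<close> propagate.
\<close>

lemma transfer_pow_hoelder:
  fixes h :: "'a::finite letter_seq \<Rightarrow> real"
  assumes rank: "CARD('a) \<ge> 2" and \<beta>: "1/2 \<le> \<beta>" "\<beta> < 1"
    and h: "hoelder_with K \<beta> inf_words h"
  shows "hoelder_with (3 * K * \<beta> ^ n) \<beta> inf_words ((transfer ^^ n) h)"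
proof -
  have K: "0 \<le> K" by (rule hoelder_with_nonneg[OF h])
  have same: "\<bar>(transfer ^^ n) h x - (transfer ^^ n) h y\<bar> \<le> K * \<beta> ^ (n + Suc N)"
    if "x \<in> inf_words" "y \<in> inf_words" "\<And>i. i < Suc N \<Longrightarrow> x i = y i" for x y N n
    using that
  proof (induction n arbitrary: x y N)
    case 0
    then show ?case using hoelder_withD[OF h, of x y "Suc N"] by simp
  next
    case (Suc n)
    have p: "preceding x = preceding y"
      using Suc.prems(3)[of 0] by (simp add: preceding_def)
    have "\<bar>transfer (\<lambda>z. (transfer ^^ n) h z) x - transfer (\<lambda>z. (transfer ^^ n) h z) y\<bar>
        = \<bar>(\<Sum>l\<in>preceding x. (transfer ^^ n) h (scons l x) - (transfer ^^ n) h (scons l y))\<bar>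
           / branching TYPE('a)"
      using branching_pos[where 'a='a]
      by (simp add: transfer_def p[symmetric] sum_subtractf abs_divide diff_divide_distrib[symmetric])
    also have "\<bar>(\<Sum>l\<in>preceding x. (transfer ^^ n) h (scons l x) - (transfer ^^ n) h (scons l y))\<bar>
        \<le> card (preceding x) * (K * \<beta> ^ (n + Suc (Suc N)))"
    proof (intro order.trans[OF sum_abs] sum_bounded_above Suc.IH)
      fix l assume "l \<in> preceding x"
      then show "scons l x \<in> inf_words" "scons l y \<in> inf_words"
        using Suc.prems p by (auto intro: scons_inf_words)
      fix i assume "i < Suc (Suc N)"
      then show "scons l x i = scons l y i"
        using Suc.prems(3) by (simp add: scons_def split: nat.split)
    qed
    finally show ?case
      using branching_pos[where 'a='a]
      by (simp add: card_preceding[OF Suc.prems(1)] divide_simps mult.commute)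
  qed
  have osc: "\<bar>(transfer ^^ n) h x - (transfer ^^ n) h y\<bar> \<le> 3 * K * \<beta> ^ n"
    if "x \<in> inf_words" "y \<in> inf_words" for x y n
    using that
  proof (induction n arbitrary: x y)
    case 0
    then show ?case using hoelder_withD[OF h, of x y 0] K by simp
  next
    case (Suc n)
    show ?case
    proof (cases "x 0 = y 0")
      case True
      then have "\<bar>(transfer ^^ Suc n) h x - (transfer ^^ Suc n) h y\<bar> \<le> K * \<beta> ^ (Suc n + Suc 0)"
        by (intro same Suc.prems) auto
      also have "\<dots> \<le> K * \<beta> ^ Suc n"
        using \<beta> K by (intro mult_left_mono power_decreasing) auto
      also have "\<dots> \<le> 3 * (K * \<beta> ^ Suc n)"
        using K \<beta> by simp
      finally show ?thesis by (simp add: mult.assoc)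
    next
      case False
      have "\<bar>transfer ((transfer ^^ n) h) x - transfer ((transfer ^^ n) h) y\<bar>
          \<le> K * \<beta> ^ Suc n + (3 * K * \<beta> ^ n) / branching TYPE('a)"
      proof (rule transfer_osc_different_first[OF Suc.prems False])
        fix u v assume "u \<in> inf_words" "v \<in> inf_words" "u 0 = (v 0 :: 'a letter option)"
        then show "\<bar>(transfer ^^ n) h u - (transfer ^^ n) h v\<bar> \<le> K * \<beta> ^ Suc n"
          using same[of u v 0 n] by simp
      qed (rule Suc.IH)
      also have "(3 * K * \<beta> ^ n) / branching TYPE('a) \<le> (3 * K * \<beta> ^ n) / 3"
        using rank K \<beta> by (intro divide_left_mono) (auto simp: branching_def)
      also have "(3 * K * \<beta> ^ n) / 3 \<le> 2 * K * \<beta> ^ Suc n"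
        using mult_right_mono[OF \<beta>(1), of "2 * K * \<beta> ^ n"] K \<beta> by (simp add: mult_ac)
      finally show ?thesis by simp
    qed
  qed
  show ?thesis
  proof (rule hoelder_withI)
    fix x y :: "'a letter_seq" and N
    assume xy: "x \<in> inf_words" "y \<in> inf_words" and eq: "\<And>i. i < N \<Longrightarrow> x i = y i"
    show "\<bar>(transfer ^^ n) h x - (transfer ^^ n) h y\<bar> \<le> 3 * K * \<beta> ^ n * \<beta> ^ N"
    proof (cases N)
      case 0
      then show ?thesis using osc[OF xy] by simp
    next
      case (Suc N')
      have "K * \<beta> ^ (n + Suc N') \<le> 3 * (K * \<beta> ^ (n + Suc N'))"
        using K \<beta> by simp
      then show ?thesis
        using same[OF xy, of N' n] eq unfolding Suc by (simp add: power_add mult_ac)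
    qed
  qed
qed

section \<open>Sums over reduced words\<close>

definition prepend :: "'a letter list \<Rightarrow> 'a letter_seq \<Rightarrow> 'a letter_seq" where
  "prepend w x = foldr scons w x"

text \<open>
  A nonempty reduced word is continued to an infinite one by repeating its last letter, which never
  creates a cancellation.
\<close>

definition extend_word :: "'a letter list \<Rightarrow> 'a letter_seq" where
  "extend_word w = prepend w (\<lambda>_. Some (last w))"

lemma prepend_simps [simp]: "prepend [] x = x" "prepend (l # w) x = scons l (prepend w x)"
  by (simp_all add: prepend_def)

lemma prepend_append: "prepend (v @ w) x = prepend v (prepend w x)"
  by (simp add: prepend_def)

lemma prepend_nth: "prepend w x n = (if n < length w then Some (w ! n) else x (n - length w))"
proof (induction w arbitrary: n)
  case (Cons l w)
  then show ?case by (cases n) auto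
qed simp

lemma scons_constant [simp]: "scons c (\<lambda>_. Some c) = (\<lambda>_. Some c)"
  by (simp add: fun_eq_iff scons_def split: nat.split)

lemma extend_word_snoc: "extend_word (w @ [c]) = prepend w (\<lambda>_. Some c)"
  by (simp add: extend_word_def prepend_append)

lemma extend_word_nth: "n < length w \<Longrightarrow> extend_word w n = Some (w ! n)"
  by (simp add: extend_word_def prepend_nth)

lemma reduced_snoc_snoc [simp]:
  "reduced_word (w @ [l, c]) \<longleftrightarrow> reduced_word (w @ [l]) \<and> c \<noteq> letter_inv l"
  by (auto simp: reduced_word_def successively_append_iff)

lemma reduced_append_iff:
  "reduced_word (v @ w) \<longleftrightarrow>
     reduced_word v \<and> reduced_word w \<and> (v = [] \<or> w = [] \<or> hd w \<noteq> letter_inv (last v))"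
  by (auto simp: reduced_word_def successively_append_iff)

lemma prepend_inf_words:
  "\<lbrakk>reduced_word (w @ [the (x 0)]); x \<in> inf_words\<rbrakk> \<Longrightarrow> prepend w x \<in> inf_words"
proof (induction w)
  case (Cons l w)
  then have r: "reduced_word (w @ [the (x 0)])" by (auto dest: reduced_ConsD)
  have "l \<in> preceding (prepend w x)"
    using Cons.prems inf_words_Some[of x 0]
    by (cases w) (auto simp: preceding_def)
  then show ?case using Cons r by (auto intro: scons_inf_words)
qed simp

lemma extend_word_inf_words:
  assumes "reduced_word w" "w \<noteq> []"
  shows "extend_word w \<in> inf_words"
proof -
  obtain v c where "w = v @ [c]" using assms(2) by (cases w rule: rev_cases) auto
  then show ?thesis using assms(1) by (auto simp: extend_word_snoc intro!: prepend_inf_words)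
qed

definition words_before :: "nat \<Rightarrow> 'a letter \<Rightarrow> 'a letter list set" where
  "words_before n c = {w. length w = n \<and> reduced_word (w @ [c])}"

definition words :: "nat \<Rightarrow> 'a letter list set" where
  "words n = {w. length w = n \<and> reduced_word w}"

lemma finite_words [simp]: "finite (words n :: 'a::finite letter list set)"
  by (rule finite_subset[OF _ finite_lists_length_eq[of UNIV n]]) (auto simp: words_def)

lemma finite_words_before [simp]: "finite (words_before n c :: 'a::finite letter list set)"
  by (rule finite_subset[OF _ finite_words[of n]])
    (auto simp: words_def words_before_def reduced_append_iff)

lemma sum_words_snoc:
  fixes g :: "'a::finite letter list \<Rightarrow> 'b::comm_monoid_add"
  shows "(\<Sum>w | w \<in> words (Suc n) \<and> last w \<in> A. g w) = (\<Sum>l\<in>A. \<Sum>w\<in>words_before n l. g (w @ [l]))"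
proof -
  have "(\<Sum>l\<in>A. \<Sum>w\<in>words_before n l. g (w @ [l]))
      = (\<Sum>(l, w)\<in>Sigma A (words_before n). g (w @ [l]))"
    by (subst sum.Sigma) auto
  also have "\<dots> = (\<Sum>w | w \<in> words (Suc n) \<and> last w \<in> A. g w)"
  proof (rule sum.reindex_bij_witness[of _ "\<lambda>w. (last w, butlast w)" "\<lambda>(l, w). w @ [l]"])
    fix w :: "'a letter list" assume "w \<in> {w. w \<in> words (Suc n) \<and> last w \<in> A}"
    then have w: "w \<noteq> []" "length w = Suc n" "reduced_word w" "last w \<in> A"
      by (auto simp: words_def)
    then show "(case (last w, butlast w) of (l, w) \<Rightarrow> w @ [l]) = w"
      by simp
    show "(last w, butlast w) \<in> Sigma A (words_before n)"
      using w by (simp add: words_before_def)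
  qed (auto simp: words_before_def words_def)
  finally show ?thesis by simp
qed

lemma transfer_pow_sum:
  fixes h :: "'a::finite letter_seq \<Rightarrow> 'b::real_vector"
  assumes "x \<in> inf_words"
  shows "branching TYPE('a) ^ n *\<^sub>R (transfer ^^ n) h x
           = (\<Sum>w\<in>words_before n (the (x 0)). h (prepend w x))"
  using assms
proof (induction n arbitrary: x)
  case 0
  have "words_before 0 (the (x 0)) = {[]}" by (auto simp: words_before_def)
  then show ?case by simp
next
  case (Suc n)
  have q: "branching TYPE('a) \<noteq> 0" using branching_pos[where 'a='a] by simp
  have W: "words_before (Suc n) (the (x 0)) = {w. w \<in> words (Suc n) \<and> last w \<in> preceding x}"
  proof (rule Set.set_eqI)
    fix w :: "'a letter list"
    show "w \<in> words_before (Suc n) (the (x 0)) \<longleftrightarrow> w \<in> {w. w \<in> words (Suc n) \<and> last w \<in> preceding x}"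
      by (cases w rule: rev_cases)
        (use inf_words_Some[OF Suc.prems, of 0] in \<open>auto simp: words_before_def words_def preceding_def\<close>)
  qed
  have "branching TYPE('a) ^ Suc n *\<^sub>R (transfer ^^ Suc n) h x
      = (\<Sum>l\<in>preceding x. branching TYPE('a) ^ n *\<^sub>R (transfer ^^ n) h (scons l x))"
    using q by (simp add: transfer_def scaleR_sum_right)
  also have "\<dots> = (\<Sum>l\<in>preceding x. \<Sum>w\<in>words_before n l. h (prepend (w @ [l]) x))"
    using Suc by (intro sum.cong) (auto simp: scons_inf_words prepend_append)
  finally show ?case by (simp add: sum_words_snoc W)
qed

text \<open>
  Splitting the reduced words by their last letter \<open>c\<close> turns a uniform average over words into values
  of iterates of the operator at the constant words \<open>c c c \<dots>\<close>.
\<close>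

lemma sum_words_extend:
  fixes h :: "'a::finite letter_seq \<Rightarrow> 'b::real_vector"
  shows "(\<Sum>w\<in>words (Suc n). h (extend_word w))
    = branching TYPE('a) ^ n *\<^sub>R (\<Sum>c\<in>UNIV. (transfer ^^ n) h (\<lambda>_. Some c))"
  using sum_words_snoc[of "\<lambda>w. h (extend_word w)" n UNIV]
  by (simp add: scaleR_sum_right transfer_pow_sum extend_word_snoc)

lemma prefix_cylinder:
  assumes "x \<in> inf_words"
  shows "\<exists>w\<in>words n. x \<in> cylinder w"
proof -
  define w where "w = map (\<lambda>i. the (x i)) [0..<n]"
  have wi: "length w = n" "\<And>i. i < n \<Longrightarrow> w ! i = the (x i)"
    by (simp_all add: w_def)
  have "w \<in> words n"
    using wi(1) inf_words_step[OF assms]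
    by (simp add: words_def reduced_word_def successively_conv_nth wi(2))
  moreover have "x \<in> cylinder w"
    using assms inf_words_Some[OF assms] by (simp add: cylinder_def wi)
  ultimately show ?thesis by blast
qed

section \<open>Hoelder functions\<close>

definition hoelder :: "real \<Rightarrow> ('a letter_seq \<Rightarrow> real) \<Rightarrow> bool" where
  "hoelder \<beta> h \<longleftrightarrow> (\<exists>K. hoelder_with K \<beta> inf_words h)"

lemma hoelder_const [simp]:
  "0 \<le> \<beta> \<Longrightarrow> hoelder \<beta> (\<lambda>_. c)"
  by (auto simp: hoelder_def hoelder_with_def intro!: exI[of _ 0])

lemma hoelder_bounded:
  assumes "hoelder \<beta> h"
  shows "\<exists>A>0. \<forall>x\<in>inf_words. \<bar>h x\<bar> \<le> A"
proof -
  obtain K where K: "hoelder_with K \<beta> inf_words h" using assms by (auto simp: hoelder_def)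
  define z :: "'a letter_seq" where "z = (\<lambda>_. Some undefined)"
  have "\<bar>h x\<bar> \<le> \<bar>h z\<bar> + K + 1" if "x \<in> inf_words" for x
    using hoelder_withD[OF K that, of z 0] by (simp add: z_def)
  moreover have "\<bar>h z\<bar> + K + 1 > 0" using hoelder_with_nonneg[OF K] by simp
  ultimately show ?thesis by blast
qed

lemma hoelder_add:
  assumes "hoelder \<beta> g" "hoelder \<beta> h"
  shows "hoelder \<beta> (\<lambda>x. g x + h x)"
proof -
  obtain K K' where K: "hoelder_with K \<beta> inf_words g" "hoelder_with K' \<beta> inf_words h"
    using assms by (auto simp: hoelder_def)
  have "hoelder_with (K + K') \<beta> inf_words (\<lambda>x. g x + h x)"
  proof (rule hoelder_withI)
    fix x y :: "'a letter_seq" and N assume "x \<in> inf_words" "y \<in> inf_words" "\<And>i. i < N \<Longrightarrow> x i = y i"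
    then show "\<bar>g x + h x - (g y + h y)\<bar> \<le> (K + K') * \<beta> ^ N"
      using hoelder_withD[OF K(1), of x y N] hoelder_withD[OF K(2), of x y N] by (simp add: distrib_right)
  qed
  then show ?thesis by (auto simp: hoelder_def)
qed

lemma hoelder_mult:
  assumes "0 \<le> \<beta>" "hoelder \<beta> g" "hoelder \<beta> h"
  shows "hoelder \<beta> (\<lambda>x. g x * h x)"
proof -
  obtain K K' where K: "hoelder_with K \<beta> inf_words g" "hoelder_with K' \<beta> inf_words h"
    using assms by (auto simp: hoelder_def)
  obtain A B where AB: "\<And>x. x \<in> inf_words \<Longrightarrow> \<bar>g x\<bar> \<le> A" "\<And>x. x \<in> inf_words \<Longrightarrow> \<bar>h x\<bar> \<le> B" "0 < A" "0 < B"
    using hoelder_bounded[OF assms(2)] hoelder_bounded[OF assms(3)] by blast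
  have "hoelder_with (K * B + A * K') \<beta> inf_words (\<lambda>x. g x * h x)"
  proof (rule hoelder_withI)
    fix x y :: "'a letter_seq" and N
    assume xy: "x \<in> inf_words" "y \<in> inf_words" and eq: "\<And>i. i < N \<Longrightarrow> x i = y i"
    have "\<bar>g x * h x - g y * h y\<bar> = \<bar>(g x - g y) * h x + g y * (h x - h y)\<bar>"
      by (simp add: algebra_simps)
    also have "\<dots> \<le> \<bar>g x - g y\<bar> * \<bar>h x\<bar> + \<bar>g y\<bar> * \<bar>h x - h y\<bar>"
      by (intro order.trans[OF abs_triangle_ineq]) (simp add: abs_mult)
    also have "\<dots> \<le> (K * \<beta> ^ N) * B + A * (K' * \<beta> ^ N)"
      using AB xy eq hoelder_with_nonneg[OF K(1)] \<open>0 \<le> \<beta>\<close>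
      by (intro add_mono mult_mono hoelder_withD[OF K(1)] hoelder_withD[OF K(2)]) auto
    finally show "\<bar>g x * h x - g y * h y\<bar> \<le> (K * B + A * K') * \<beta> ^ N"
      by (simp add: algebra_simps)
  qed
  then show ?thesis by (auto simp: hoelder_def)
qed

lemma hoelder_diff: "\<lbrakk>0 \<le> \<beta>; hoelder \<beta> g; hoelder \<beta> h\<rbrakk> \<Longrightarrow> hoelder \<beta> (\<lambda>x. g x - h x)"
  using hoelder_add[of \<beta> g "\<lambda>x. (-1) * h x"] hoelder_mult[of \<beta> "\<lambda>_. -1" h] by simp

lemma hoelder_shift:
  assumes "0 < \<beta>" "\<beta> < 1" "hoelder \<beta> h"
  shows "hoelder \<beta> (\<lambda>x. h (seq_shift x))"
proof -
  obtain K where K: "hoelder_with K \<beta> inf_words h" using assms by (auto simp: hoelder_def)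
  have K0: "0 \<le> K" by (rule hoelder_with_nonneg[OF K])
  have "hoelder_with (K / \<beta>) \<beta> inf_words (\<lambda>x. h (seq_shift x))"
  proof (rule hoelder_withI)
    fix x y :: "'a letter_seq" and N
    assume xy: "x \<in> inf_words" "y \<in> inf_words" and eq: "\<And>i. i < N \<Longrightarrow> x i = y i"
    have "\<bar>h (seq_shift x) - h (seq_shift y)\<bar> \<le> K * \<beta> ^ (N - 1)"
      by (rule hoelder_withD[OF K]) (use xy eq in \<open>auto simp: seq_shift_def\<close>)
    also have "\<dots> \<le> K / \<beta> * \<beta> ^ N"
    proof (cases N)
      case 0
      then show ?thesis using assms K0 by (simp add: divide_simps mult_left_le)
    qed (use assms in simp)
    finally show "\<bar>h (seq_shift x) - h (seq_shift y)\<bar> \<le> K / \<beta> * \<beta> ^ N" .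
  qed
  then show ?thesis by (auto simp: hoelder_def)
qed

lemma hoelder_birkhoff_sum:
  assumes "0 < \<beta>" "\<beta> < 1" "hoelder \<beta> h"
  shows "hoelder \<beta> (birkhoff_sum h n)"
proof -
  have 1: "hoelder \<beta> (\<lambda>x. h ((seq_shift ^^ j) x))" for j
  proof (induction j)
    case (Suc j)
    show ?case using hoelder_shift[OF assms(1,2) Suc] by (simp add: funpow_swap1)
  qed (use assms in simp)
  have "hoelder \<beta> (\<lambda>x. \<Sum>j<n. h ((seq_shift ^^ j) x))"
    by (induction n) (use assms 1 hoelder_add in auto)
  then show ?thesis by (simp add: birkhoff_sum_def[abs_def])
qed

lemma birkhoff_sum_Suc: "birkhoff_sum h (Suc n) x = h x + birkhoff_sum h n (seq_shift x)"
  unfolding birkhoff_sum_def by (subst sum.lessThan_Suc_shift) (simp add: funpow_swap1)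

lemma birkhoff_sum_0 [simp]: "birkhoff_sum h 0 x = 0"
  by (simp add: birkhoff_sum_def)

section \<open>Mean values and the Poisson equation\<close>

text \<open>
  The Hoelder exponent enters through \<open>\<beta>\<close>. Enlarging \<open>\<beta>\<close> weakens the Hoelder condition, so the bound
  \<open>1 / 2 \<le> \<beta>\<close> of the contraction estimate can always be achieved.
\<close>

locale max_entropy_shift =
  fixes \<theta> :: real and \<mu> :: "'a::finite letter_seq measure" and \<beta> q :: real
  defines "q \<equiv> branching TYPE('a)"
  assumes rank: "2 \<le> CARD('a)" and max_entropy: "max_entropy_measure \<theta> \<mu>"
    and beta_ge: "1/2 \<le> \<beta>" and beta_less: "\<beta> < 1"
begin

sublocale prob_space \<mu>
  using max_entropy by (simp add: max_entropy_measure_def)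

lemma beta_pos [simp]: "0 < \<beta>" "0 \<le> \<beta>"
  using beta_ge by auto

lemma space_mu: "space \<mu> = inf_words"
  using max_entropy by (simp add: max_entropy_measure_def)

lemma q_ge: "3 \<le> q"
  using rank by (simp add: q_def branching_def)

lemma measure_cylinder:
  "w \<in> words (Suc n) \<Longrightarrow> prob (cylinder w) = 1 / ((q + 1) * q ^ n)"
proof -
  assume w: "w \<in> words (Suc n)"
  then have "w \<noteq> []" "reduced_word w" "length w - 1 = n"
    by (auto simp: words_def)
  then have "prob (cylinder w) = 1 / (2 * real CARD('a)) * (1 / (2 * real CARD('a) - 1)) ^ n"
    using max_entropy by (simp add: max_entropy_measure_def)
  then show ?thesis by (simp add: q_def branching_def power_one_over)
qed

text \<open>
  Non-measurable sets have measure zero by convention, whereas cylinders have positive measure.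
\<close>

lemma cylinder_sets: "w \<in> words (Suc n) \<Longrightarrow> cylinder w \<in> sets \<mu>"
proof (rule ccontr)
  assume "w \<in> words (Suc n)" "cylinder w \<notin> sets \<mu>"
  then show False
    using measure_cylinder[of w n] measure_notin_sets[of "cylinder w" \<mu>] q_ge by simp
qed

text \<open>
  The approximation of \<open>h\<close> by a function of the first \<open>n + 1\<close> letters. It gives the measurability of
  Hoelder functions, as a limit of simple functions, and their integrals, as limits of averages over
  words.
\<close>

definition step_approx :: "('a letter_seq \<Rightarrow> real) \<Rightarrow> nat \<Rightarrow> 'a letter_seq \<Rightarrow> real" where
  "step_approx h n x = (\<Sum>w\<in>words (Suc n). h (extend_word w) * indicator (cylinder w) x)"

lemma step_approx_eq:
  assumes "x \<in> inf_words"
  shows "\<exists>y\<in>inf_words. (\<forall>i<Suc n. x i = y i) \<and> step_approx h n x = h y"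
proof -
  obtain w where w: "w \<in> words (Suc n)" and xw: "x \<in> cylinder w"
    using prefix_cylinder[OF assms] by blast
  have wi: "length w = Suc n" "\<And>i. i < Suc n \<Longrightarrow> x i = Some (w ! i)"
    using w xw by (auto simp: words_def cylinder_def)
  have u: "v = w" if "v \<in> words (Suc n)" "x \<in> cylinder v" for v
    using that wi by (intro nth_equalityI) (auto simp: words_def cylinder_def)
  have "h (extend_word v) * indicator (cylinder v) x = (if v = w then h (extend_word w) else 0)"
    if "v \<in> words (Suc n)" for v
    using u[OF that] xw by (cases "v = w") (auto simp: indicator_def)
  then have "step_approx h n x = (\<Sum>v\<in>words (Suc n). if v = w then h (extend_word w) else 0)"
    unfolding step_approx_def by (intro sum.cong) simp_all
  then have "step_approx h n x = h (extend_word w)" using w by simp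
  moreover have "extend_word w \<in> inf_words" using w by (intro extend_word_inf_words) (auto simp: words_def)
  moreover have "\<forall>i<Suc n. x i = extend_word w i"
    using wi extend_word_nth[of _ w] by simp
  ultimately show ?thesis by blast
qed

lemma step_approx_error:
  assumes "hoelder_with K \<beta> inf_words h" "x \<in> inf_words"
  shows "\<bar>h x - step_approx h n x\<bar> \<le> K * \<beta> ^ Suc n"
  using step_approx_eq[OF assms(2), of n h] hoelder_withD[OF assms] by metis

lemma step_approx_measurable [measurable]: "step_approx h n \<in> borel_measurable \<mu>"
  unfolding step_approx_def[abs_def] using cylinder_sets
  by (intro borel_measurable_sum borel_measurable_times borel_measurable_indicator) auto

lemma tendsto_beta_pow: "(\<lambda>n. K * \<beta> ^ n) \<longlonglongrightarrow> 0"
  using LIMSEQ_power_zero[of \<beta>] beta_less by (auto intro!: tendsto_mult_right_zero)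

lemma hoelder_measurable:
  assumes "hoelder \<beta> h"
  shows "h \<in> borel_measurable \<mu>"
proof -
  obtain K where K: "hoelder_with K \<beta> inf_words h" using assms by (auto simp: hoelder_def)
  show ?thesis
  proof (rule borel_measurable_LIMSEQ_real)
    fix x assume "x \<in> space \<mu>"
    then have "\<forall>n. norm (step_approx h n x - h x) \<le> K * \<beta> ^ Suc n"
      using step_approx_error[OF K, of x] by (simp add: space_mu abs_minus_commute)
    then have "(\<lambda>n. step_approx h n x - h x) \<longlonglongrightarrow> 0"
      by (rule Lim_null_comparison[OF always_eventually LIMSEQ_Suc[OF tendsto_beta_pow]])
    then show "(\<lambda>n. step_approx h n x) \<longlonglongrightarrow> h x" by (simp add: LIM_zero_iff)
  qed simp
qed

lemma hoelder_integrable: "hoelder \<beta> h \<Longrightarrow> integrable \<mu> h"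
proof -
  assume h: "hoelder \<beta> h"
  then obtain A where "\<forall>x\<in>inf_words. \<bar>h x\<bar> \<le> A" using hoelder_bounded by blast
  then show ?thesis
    using hoelder_measurable[OF h] by (intro integrable_const_bound[of _ A]) (auto simp: space_mu)
qed

text \<open>
  All cylinders of the same length have the same mass, so this integral is an average over words.
\<close>

lemma step_approx_integral:
  "(\<integral>x. step_approx h n x \<partial>\<mu>) = (\<Sum>c\<in>UNIV. (transfer ^^ n) h (\<lambda>_. Some c)) / (q + 1)"
proof -
  have "(\<integral>x. step_approx h n x \<partial>\<mu>) = (\<Sum>w\<in>words (Suc n). h (extend_word w) * prob (cylinder w))"
    unfolding step_approx_def using cylinder_sets
    by (subst Bochner_Integration.integral_sum) (auto simp: emeasure_eq_measure sets.Int_space_eq2)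
  also have "\<dots> = (\<Sum>w\<in>words (Suc n). h (extend_word w)) / ((q + 1) * q ^ n)"
    by (simp add: measure_cylinder sum_divide_distrib)
  also have "\<dots> = (\<Sum>c\<in>UNIV. (transfer ^^ n) h (\<lambda>_. Some c)) / (q + 1)"
    using q_ge by (simp add: sum_words_extend q_def)
  finally show ?thesis .
qed

lemma step_approx_integral_tendsto:
  assumes "hoelder \<beta> h"
  shows "(\<lambda>n. \<integral>x. step_approx h n x \<partial>\<mu>) \<longlonglongrightarrow> (\<integral>x. h x \<partial>\<mu>)"
proof -
  obtain K where K: "hoelder_with K \<beta> inf_words h" using assms by (auto simp: hoelder_def)
  have i: "integrable \<mu> (step_approx h n)" for n
    unfolding step_approx_def[abs_def] using cylinder_sets
    by (intro Bochner_Integration.integrable_sum integrable_mult_right)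
      (auto simp: emeasure_eq_measure integrable_indicator_iff)
  have "norm ((\<integral>x. step_approx h n x \<partial>\<mu>) - (\<integral>x. h x \<partial>\<mu>)) \<le> K * \<beta> ^ Suc n" for n
  proof -
    have "norm (\<integral>x. step_approx h n x - h x \<partial>\<mu>) \<le> (\<integral>x. K * \<beta> ^ Suc n \<partial>\<mu>)"
    proof (rule order.trans[OF integral_norm_bound integral_mono])
      fix x assume "x \<in> space \<mu>"
      then show "norm (step_approx h n x - h x) \<le> K * \<beta> ^ Suc n"
        using step_approx_error[OF K, of x n] by (simp add: space_mu abs_minus_commute)
    qed (use i hoelder_integrable[OF assms] in auto)
    then show ?thesis
      using i hoelder_integrable[OF assms] by (simp add: prob_space)
  qed
  then have "(\<lambda>n. (\<integral>x. step_approx h n x \<partial>\<mu>) - (\<integral>x. h x \<partial>\<mu>)) \<longlonglongrightarrow> 0"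
    by (intro Lim_null_comparison[OF always_eventually LIMSEQ_Suc[OF tendsto_beta_pow]] allI)
  then show ?thesis by (simp add: LIM_zero_iff)
qed

text \<open>
  Averages over words of length \<open>m + n + 1\<close> are averages of values of the \<open>n\<close>-th iterate, which all lie
  close to each other; letting \<open>m\<close> tend to infinity turns them into the integral.
\<close>

lemma transfer_pow_tends_to_mean:
  assumes h: "hoelder_with K \<beta> inf_words h" and x: "x \<in> inf_words"
  shows "\<bar>(transfer ^^ n) h x - (\<integral>y. h y \<partial>\<mu>)\<bar> \<le> 3 * K * \<beta> ^ n"
proof -
  have osc: "hoelder_with (3 * K * \<beta> ^ n) \<beta> inf_words ((transfer ^^ n) h)"
    by (rule transfer_pow_hoelder[OF rank beta_ge beta_less h])
  define a where "a = (transfer ^^ n) h x"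
  have 1: "\<bar>(transfer ^^ m) ((transfer ^^ n) h) y - a\<bar> \<le> 3 * K * \<beta> ^ n" if "y \<in> inf_words" for y m
  proof -
    have "norm ((transfer ^^ m) ((transfer ^^ n) h) y - (transfer ^^ m) (\<lambda>_. a) y) \<le> 3 * K * \<beta> ^ n"
    proof (rule norm_transfer_pow_diff_le[OF that])
      fix z :: "'a letter_seq" assume "z \<in> inf_words"
      then show "norm ((transfer ^^ n) h z - a) \<le> 3 * K * \<beta> ^ n"
        using hoelder_withD[OF osc _ x, of z 0] by (simp add: a_def)
    qed
    then show ?thesis by (simp add: transfer_pow_const[OF that])
  qed
  have 2: "\<bar>a - (\<integral>y. step_approx h (m + n) y \<partial>\<mu>)\<bar> \<le> 3 * K * \<beta> ^ n" for m
  proof -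
    have card: "real (card (UNIV :: 'a letter set)) = q + 1"
      by (simp add: q_def branching_def)
    have "(q + 1) * ((\<integral>y. step_approx h (m + n) y \<partial>\<mu>) - a)
        = (\<Sum>c\<in>UNIV. (transfer ^^ m) ((transfer ^^ n) h) (\<lambda>_. Some c) - a)"
      using q_ge card by (simp add: step_approx_integral sum_subtractf funpow_add field_simps)
    moreover have "\<bar>\<Sum>c\<in>(UNIV :: 'a letter set). (transfer ^^ m) ((transfer ^^ n) h) (\<lambda>_. Some c) - a\<bar>
        \<le> (q + 1) * (3 * K * \<beta> ^ n)"
      unfolding card[symmetric]
      by (intro order.trans[OF sum_abs] sum_bounded_above 1) auto
    ultimately have "(q + 1) * \<bar>(\<integral>y. step_approx h (m + n) y \<partial>\<mu>) - a\<bar> \<le> (q + 1) * (3 * K * \<beta> ^ n)"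
      using q_ge abs_mult[of "q + 1" "(\<integral>y. step_approx h (m + n) y \<partial>\<mu>) - a"] by simp
    then show ?thesis using q_ge by (simp add: abs_minus_commute)
  qed
  have "hoelder \<beta> h" using h by (auto simp: hoelder_def)
  from LIMSEQ_ignore_initial_segment[OF step_approx_integral_tendsto[OF this], of n]
  have "(\<lambda>m. \<bar>a - (\<integral>y. step_approx h (m + n) y \<partial>\<mu>)\<bar>) \<longlonglongrightarrow> \<bar>a - (\<integral>y. h y \<partial>\<mu>)\<bar>"
    by (intro tendsto_intros)
  then show ?thesis
    unfolding a_def[symmetric] using 2 by (intro LIMSEQ_le_const2) auto
qed

lemma hoelder_transfer:
  fixes h :: "'a letter_seq \<Rightarrow> real"
  assumes "hoelder \<beta> h"
  shows "hoelder \<beta> (transfer h)"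
proof -
  obtain K where "hoelder_with K \<beta> inf_words h" using assms by (auto simp: hoelder_def)
  from transfer_pow_hoelder[OF rank beta_ge beta_less this, of 1] show ?thesis
    by (auto simp: hoelder_def)
qed

lemma integral_transfer:
  assumes "hoelder \<beta> h"
  shows "(\<integral>x. transfer h x \<partial>\<mu>) = (\<integral>x. h x \<partial>\<mu>)"
proof -
  define z :: "'a letter_seq" where "z = (\<lambda>_. Some undefined)"
  have z: "z \<in> inf_words" by (simp add: z_def)
  have lim: "(\<lambda>n. (transfer ^^ n) g z) \<longlonglongrightarrow> (\<integral>x. g x \<partial>\<mu>)" if g: "hoelder \<beta> g" for g
  proof -
    obtain K where "hoelder_with K \<beta> inf_words g" using g by (auto simp: hoelder_def)
    then have "(\<lambda>n. (transfer ^^ n) g z - (\<integral>y. g y \<partial>\<mu>)) \<longlonglongrightarrow> 0"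
      using transfer_pow_tends_to_mean[of K g z] z
      by (intro Lim_null_comparison[OF always_eventually tendsto_beta_pow] allI) simp
    then show ?thesis by (simp add: LIM_zero_iff)
  qed
  have "(\<lambda>n. (transfer ^^ Suc n) h z) \<longlonglongrightarrow> (\<integral>x. transfer h x \<partial>\<mu>)"
    using lim[OF hoelder_transfer[OF assms]] by (simp add: funpow_swap1)
  then show ?thesis
    using LIMSEQ_Suc[OF lim[OF assms]] by (rule LIMSEQ_unique)
qed

text \<open>
  The solution is the sum of \<open>(transfer ^^ n) h\<close> over all \<open>n\<close>, a geometrically convergent series of
  Hoelder functions.
\<close>

lemma poisson_equation:
  assumes "hoelder \<beta> h" and mean: "(\<integral>x. h x \<partial>\<mu>) = 0"
  shows "\<exists>v. hoelder \<beta> v \<and> (\<forall>x\<in>inf_words. v x - transfer v x = h x)"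
proof -
  obtain K where K: "hoelder_with K \<beta> inf_words h" using assms by (auto simp: hoelder_def)
  define v where "v x = (\<Sum>n. (transfer ^^ n) h x)" for x
  have geo: "summable (\<lambda>n. C * \<beta> ^ n)" for C
    using beta_less by (intro summable_mult summable_geometric) simp
  have sums: "(\<lambda>n. (transfer ^^ n) h x) sums v x" if "x \<in> inf_words" for x
    unfolding v_def
    by (rule summable_sums, rule summable_comparison_test'[OF geo[of "3 * K"]])
      (use transfer_pow_tends_to_mean[OF K that] mean in simp)
  have "hoelder_with (3 * K / (1 - \<beta>)) \<beta> inf_words v"
  proof (rule hoelder_withI)
    fix x y :: "'a letter_seq" and N
    assume xy: "x \<in> inf_words" "y \<in> inf_words" and eq: "\<And>i. i < N \<Longrightarrow> x i = y i"
    have s: "(\<lambda>n. (transfer ^^ n) h x - (transfer ^^ n) h y) sums (v x - v y)"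
      by (intro sums_diff sums xy)
    have s2: "(\<lambda>n. (3 * K * \<beta> ^ N) * \<beta> ^ n) sums ((3 * K * \<beta> ^ N) * (1 / (1 - \<beta>)))"
      using beta_less by (intro sums_mult geometric_sums) simp
    have "norm (\<Sum>n. (transfer ^^ n) h x - (transfer ^^ n) h y) \<le> (\<Sum>n. (3 * K * \<beta> ^ N) * \<beta> ^ n)"
    proof (rule norm_suminf_le[OF _ geo])
      fix n
      show "norm ((transfer ^^ n) h x - (transfer ^^ n) h y) \<le> (3 * K * \<beta> ^ N) * \<beta> ^ n"
        using hoelder_withD[OF transfer_pow_hoelder[OF rank beta_ge beta_less K] xy, of N n] eq
        by (simp add: mult_ac)
    qed
    then show "\<bar>v x - v y\<bar> \<le> 3 * K / (1 - \<beta>) * \<beta> ^ N"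
      unfolding sums_unique[OF s, symmetric] sums_unique[OF s2, symmetric] by simp
  qed
  moreover have "v x - transfer v x = h x" if x: "x \<in> inf_words" for x
  proof -
    have "(\<lambda>n. (1 / q) *\<^sub>R (\<Sum>l\<in>preceding x. (transfer ^^ n) h (scons l x))) sums transfer v x"
      unfolding transfer_def[of v] q_def by (intro sums_scaleR_right sums_sum sums scons_inf_words x)
    then have "(\<lambda>n. (transfer ^^ Suc n) h x) sums transfer v x"
      by (simp add: q_def transfer_def[of "(transfer ^^ _) h"])
    then have "(\<lambda>n. (transfer ^^ n) h x) sums (transfer v x + (transfer ^^ 0) h x)"
      by (rule sums_Suc)
    from sums_unique2[OF this sums[OF x]] show ?thesis by simp
  qed
  ultimately show ?thesis by (auto simp: hoelder_def)
qed

text \<open>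
  Gordin's decomposition. With \<open>v\<close> solving the Poisson equation for \<open>g\<close>, the choices \<open>u = transfer v\<close>
  and \<open>\<xi> = v - u \<circ> seq_shift\<close> work, because \<open>transfer\<close> undoes the composition with the shift.
\<close>

lemma martingale_decomposition:
  assumes "hoelder \<beta> g" "(\<integral>x. g x \<partial>\<mu>) = 0"
  shows "\<exists>\<xi> u. hoelder \<beta> \<xi> \<and> hoelder \<beta> u \<and> (\<forall>x\<in>inf_words. transfer \<xi> x = 0) \<and>
    (\<forall>x\<in>inf_words. g x = \<xi> x + u (seq_shift x) - u x)"
proof -
  obtain v where v: "hoelder \<beta> v" "\<And>x. x \<in> inf_words \<Longrightarrow> v x - transfer v x = g x"
    using poisson_equation[OF assms] by blast
  define u \<xi> where "u = transfer v" and "\<xi> x = v x - transfer v (seq_shift x)" for x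
  have "hoelder \<beta> u" unfolding u_def by (rule hoelder_transfer[OF v(1)])
  moreover have "hoelder \<beta> \<xi>" unfolding \<xi>_def
    using v(1) hoelder_transfer[OF v(1)] beta_less by (intro hoelder_diff hoelder_shift) auto
  moreover have "transfer \<xi> x = 0" if "x \<in> inf_words" for x
    unfolding \<xi>_def[abs_def] by (simp add: transfer_diff transfer_shift[OF that])
  moreover have "g x = \<xi> x + u (seq_shift x) - u x" if "x \<in> inf_words" for x
    using v(2)[OF that] by (simp add: \<xi>_def u_def)
  ultimately show ?thesis by blast
qed

end

section \<open>Birkhoff sums\<close>

lemma funpow_shift_inf_words [intro]: "x \<in> inf_words \<Longrightarrow> (seq_shift ^^ j) x \<in> inf_words"
  by (induction j) auto

lemma birkhoff_sum_add:
  "birkhoff_sum h (m + n) x = birkhoff_sum h m x + birkhoff_sum h n ((seq_shift ^^ m) x)"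
  by (induction m arbitrary: x) (simp_all add: birkhoff_sum_Suc funpow_swap1)

lemma birkhoff_sum_bound:
  assumes "x \<in> inf_words" "\<And>y. y \<in> inf_words \<Longrightarrow> \<bar>h y\<bar> \<le> A"
  shows "\<bar>birkhoff_sum h n x\<bar> \<le> real n * A"
proof -
  have "\<bar>birkhoff_sum h n x\<bar> \<le> (\<Sum>j<n. \<bar>h ((seq_shift ^^ j) x)\<bar>)"
    unfolding birkhoff_sum_def by (rule sum_abs)
  also have "\<dots> \<le> real (card {..<n}) * A"
    using assms by (intro sum_bounded_above) auto
  finally show ?thesis by simp
qed

lemma birkhoff_sum_coboundary:
  assumes "x \<in> inf_words" "\<And>y. y \<in> inf_words \<Longrightarrow> f y - c = \<xi> y + u (seq_shift y) - u y"
  shows "birkhoff_sum f n x - real n * c = birkhoff_sum \<xi> n x + u ((seq_shift ^^ n) x) - u x"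
  using assms(1)
proof (induction n arbitrary: x)
  case (Suc n)
  have "birkhoff_sum f n (seq_shift x) - real n * c
      = birkhoff_sum \<xi> n (seq_shift x) + u ((seq_shift ^^ n) (seq_shift x)) - u (seq_shift x)"
    using Suc by auto
  then show ?case
    using assms(2)[OF Suc.prems] by (simp add: birkhoff_sum_Suc funpow_swap1 algebra_simps)
qed simp

section \<open>Twisted transfer operators\<close>

lemma transfer_of_real: "transfer (\<lambda>y. complex_of_real (h y)) x = of_real (transfer h x)"
  by (simp add: transfer_def scaleR_conv_of_real)

lemma transfer_pow_of_real:
  "(transfer ^^ n) (\<lambda>y. complex_of_real (h y)) x = of_real ((transfer ^^ n) h x)"
proof (induction n arbitrary: x)
  case (Suc n)
  have "(transfer ^^ n) (\<lambda>y. complex_of_real (h y)) = (\<lambda>x. of_real ((transfer ^^ n) h x))"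
    by (rule ext) (rule Suc.IH)
  then show ?case by (simp add: transfer_of_real)
qed simp

lemma transfer_pow_mult_shift:
  fixes g h :: "'a::finite letter_seq \<Rightarrow> 'b::real_algebra"
  assumes "x \<in> inf_words"
  shows "(transfer ^^ j) (\<lambda>y. g ((seq_shift ^^ j) y) * h y) x = g x * (transfer ^^ j) h x"
  using assms
proof (induction j arbitrary: h x)
  case (Suc j)
  have "transfer (\<lambda>y. g ((seq_shift ^^ Suc j) y) * h y) z = g ((seq_shift ^^ j) z) * transfer h z" for z
    using transfer_mult_shift[of "\<lambda>z. g ((seq_shift ^^ j) z)" h z] by (simp add: funpow_swap1)
  then have "transfer (\<lambda>y. g ((seq_shift ^^ Suc j) y) * h y) = (\<lambda>z. g ((seq_shift ^^ j) z) * transfer h z)"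
    by (rule ext)
  then show ?case
    using Suc.IH[OF Suc.prems, of "transfer h"] by (simp only: funpow_Suc_right comp_def)
qed simp

lemma exp_minus_approx:
  fixes u :: real
  assumes "0 \<le> u"
  shows "\<bar>exp (- u) - (1 - u)\<bar> \<le> u\<^sup>2" "\<bar>exp (- u) - 1\<bar> \<le> u"
proof -
  have 1: "1 - u \<le> exp (- u)" using exp_ge_add_one_self[of "- u"] by simp
  have "exp (- u) * (1 + u) \<le> exp (- u) * exp u"
    using exp_ge_add_one_self[of u] by (intro mult_left_mono) auto
  also have "\<dots> = 1" by (simp add: exp_minus)
  also have "1 \<le> 1 + u ^ 3" using assms by simp
  also have "\<dots> = (1 - u + u\<^sup>2) * (1 + u)"
    by (simp add: ring_distribs power2_eq_square power3_eq_cube)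
  finally have "exp (- u) \<le> 1 - u + u\<^sup>2"
    using assms by (rule_tac mult_right_le_imp_le[where c = "1 + u"]) simp_all
  then show "\<bar>exp (- u) - (1 - u)\<bar> \<le> u\<^sup>2" using 1 by simp
  show "\<bar>exp (- u) - 1\<bar> \<le> u" using 1 assms by simp
qed

lemma iexp_bound: "cmod (iexp x - 1) \<le> \<bar>x\<bar>"
  using iexp_approx1[of x 0] by simp

lemma iexp_quadratic: "cmod (iexp x - (1 + \<i> * complex_of_real x - (complex_of_real x)\<^sup>2 / 2)) \<le> \<bar>x\<bar> ^ 3 / 6"
proof -
  have "(\<Sum>k\<le>2. (\<i> * x)^k / fact k) = 1 + \<i> * complex_of_real x - (complex_of_real x)\<^sup>2 / 2"
    by (simp add: numeral_2_eq_2 power2_eq_square field_simps)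
  then show ?thesis using iexp_approx1[of x 2] by (simp add: fact_numeral eval_nat_numeral)
qed

lemma iexp_lipschitz: "cmod (iexp x - iexp y) \<le> \<bar>x - y\<bar>"
proof -
  have "iexp x - iexp y = iexp y * (iexp (x - y) - 1)"
    by (simp add: right_diff_distrib exp_diff)
  then show ?thesis using iexp_bound[of "x - y"] by (simp add: norm_mult)
qed

text \<open>
  The characteristic function of a Birkhoff sum of length \<open>n\<close> is obtained by applying the operator
  \<open>h \<mapsto> transfer (iexp (t * \<xi>) * h)\<close> repeatedly, one step for each letter.
\<close>

lemma twisted_transfer_step:
  fixes h :: "'a::finite letter_seq \<Rightarrow> complex"
  assumes "x \<in> inf_words"
  shows "(transfer ^^ Suc n) (\<lambda>y. iexp (t * birkhoff_sum \<xi> (Suc n) y) * h y) x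
       = (transfer ^^ n) (\<lambda>y. iexp (t * birkhoff_sum \<xi> n y) * transfer (\<lambda>y. iexp (t * \<xi> y) * h y) y) x"
proof -
  have "transfer (\<lambda>y. iexp (t * birkhoff_sum \<xi> (Suc n) y) * h y) z
      = iexp (t * birkhoff_sum \<xi> n z) * transfer (\<lambda>y. iexp (t * \<xi> y) * h y) z" for z
    unfolding transfer_mult_shift[of "\<lambda>z. iexp (t * birkhoff_sum \<xi> n z)", symmetric]
    by (simp add: birkhoff_sum_Suc distrib_left exp_add mult_ac)
  then have "transfer (\<lambda>y. iexp (t * birkhoff_sum \<xi> (Suc n) y) * h y)
      = (\<lambda>z. iexp (t * birkhoff_sum \<xi> n z) * transfer (\<lambda>y. iexp (t * \<xi> y) * h y) z)"
    by (rule ext)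
  then show ?thesis by (simp only: funpow_Suc_right comp_def)
qed

text \<open>
  The function \<open>1 - t\<^sup>2 / 2 * \<psi>\<close> is an eigenfunction of the twisted operator up to order three in \<open>t\<close>. The
  term of first order vanishes by \<open>transfer \<xi> = 0\<close>; in second order \<open>transfer (\<xi>\<^sup>2) + transfer \<psi>\<close>
  appears, and \<open>\<psi>\<close> is chosen to make this the constant \<open>s\<close> plus \<open>\<psi>\<close> itself.
\<close>

lemma twisted_transfer_one_step:
  fixes \<xi> \<psi> :: "'a::finite letter_seq \<Rightarrow> real"
  assumes A: "0 \<le> A" "\<And>y. y \<in> inf_words \<Longrightarrow> \<bar>\<xi> y\<bar> \<le> A" "\<And>y. y \<in> inf_words \<Longrightarrow> \<bar>\<psi> y\<bar> \<le> A"
    and mart: "\<And>y. y \<in> inf_words \<Longrightarrow> transfer \<xi> y = 0"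
    and pois: "\<And>y. y \<in> inf_words \<Longrightarrow> \<psi> y - transfer \<psi> y = transfer (\<lambda>z. (\<xi> z)\<^sup>2) y - s"
    and s: "0 \<le> s" and t: "\<bar>t\<bar> \<le> 1" and x: "x \<in> inf_words"
  shows "cmod (transfer (\<lambda>y. iexp (t * \<xi> y) * of_real (1 - t\<^sup>2 / 2 * \<psi> y)) x
      - of_real (exp (- s * t\<^sup>2 / 2) * (1 - t\<^sup>2 / 2 * \<psi> x))) \<le> (A ^ 3 + A\<^sup>2 + s\<^sup>2 + s * A) * \<bar>t\<bar> ^ 3"
proof -
  define p where "p y = 1 + \<i> * complex_of_real (t * \<xi> y) - (complex_of_real (t * \<xi> y))\<^sup>2 / 2 - of_real (t\<^sup>2 / 2 * \<psi> y)" for y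
  have t4: "t ^ 4 \<le> \<bar>t\<bar> ^ 3"
    using t power_decreasing[of 3 4 "\<bar>t\<bar>"] by simp
  have err: "cmod (iexp (t * \<xi> y) * of_real (1 - t\<^sup>2 / 2 * \<psi> y) - p y) \<le> (A ^ 3 + A\<^sup>2) * \<bar>t\<bar> ^ 3"
    if y: "y \<in> inf_words" for y
  proof -
    define d where "d = complex_of_real (t\<^sup>2 / 2 * \<psi> y)"
    have "iexp (t * \<xi> y) * of_real (1 - t\<^sup>2 / 2 * \<psi> y) - p y
      = (iexp (t * \<xi> y) - (1 + \<i> * complex_of_real (t * \<xi> y) - (complex_of_real (t * \<xi> y))\<^sup>2 / 2))
        - (iexp (t * \<xi> y) - 1) * of_real (t\<^sup>2 / 2 * \<psi> y)"
      unfolding p_def of_real_diff of_real_1 d_def[symmetric] by (simp add: algebra_simps)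
    also have "cmod \<dots> \<le> \<bar>t * \<xi> y\<bar> ^ 3 / 6 + \<bar>t * \<xi> y\<bar> * (t\<^sup>2 / 2 * \<bar>\<psi> y\<bar>)"
    proof (rule order.trans[OF norm_triangle_ineq4 add_mono])
      show "cmod (iexp (t * \<xi> y) - (1 + \<i> * complex_of_real (t * \<xi> y) - (complex_of_real (t * \<xi> y))\<^sup>2 / 2)) \<le> \<bar>t * \<xi> y\<bar> ^ 3 / 6"
        by (rule iexp_quadratic)
      have "cmod (of_real (t\<^sup>2 / 2 * \<psi> y)) = t\<^sup>2 / 2 * \<bar>\<psi> y\<bar>"
        unfolding norm_of_real by (simp add: abs_mult)
      then show "cmod ((iexp (t * \<xi> y) - 1) * of_real (t\<^sup>2 / 2 * \<psi> y)) \<le> \<bar>t * \<xi> y\<bar> * (t\<^sup>2 / 2 * \<bar>\<psi> y\<bar>)"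
        unfolding norm_mult by (intro mult_mono iexp_bound) auto
    qed
    also have "\<dots> \<le> (\<bar>t\<bar> * A) ^ 3 / 6 + (\<bar>t\<bar> * A) * (t\<^sup>2 / 2 * A)"
    proof -
      have "\<bar>t * \<xi> y\<bar> \<le> \<bar>t\<bar> * A"
        unfolding abs_mult using A(2)[OF y] by (rule mult_left_mono) simp
      moreover have "t\<^sup>2 / 2 * \<bar>\<psi> y\<bar> \<le> t\<^sup>2 / 2 * A"
        using A(3)[OF y] by (rule mult_left_mono) simp
      ultimately show ?thesis
        using A(1) by (intro add_mono divide_right_mono power_mono[of "\<bar>t * \<xi> y\<bar>"] mult_mono[of "\<bar>t * \<xi> y\<bar>"]) auto
    qed
    also have "\<dots> = (A ^ 3 / 6 + A\<^sup>2 / 2) * \<bar>t\<bar> ^ 3"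
      by (simp add: power_mult_distrib power2_eq_square power3_eq_cube algebra_simps)
    also have "\<dots> \<le> (A ^ 3 + A\<^sup>2) * \<bar>t\<bar> ^ 3"
      using A by (intro mult_right_mono add_mono) auto
    finally show ?thesis .
  qed
  have "transfer p x = 1 + \<i> * (of_real t * complex_of_real (transfer \<xi> x))
      - of_real (t\<^sup>2 / 2 * transfer (\<lambda>z. (\<xi> z)\<^sup>2) x) - of_real (t\<^sup>2 / 2 * transfer \<psi> x)"
  proof -
    have "p = (\<lambda>y. 1 + \<i> * (of_real t * complex_of_real (\<xi> y)) - of_real (t\<^sup>2 / 2 * (\<xi> y)\<^sup>2) - of_real (t\<^sup>2 / 2 * \<psi> y))"
      by (rule ext) (simp add: p_def power_mult_distrib)
    then show ?thesis
      by (simp only: transfer_diff transfer_add transfer_of_real transfer_mult_left transfer_const[OF x])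
  qed
  also have "\<dots> = of_real (1 - t\<^sup>2 / 2 * s - t\<^sup>2 / 2 * \<psi> x)"
  proof -
    have "transfer (\<lambda>z. (\<xi> z)\<^sup>2) x = s + \<psi> x - transfer \<psi> x" using pois[OF x] by simp
    then have "1 - t\<^sup>2 / 2 * s - t\<^sup>2 / 2 * \<psi> x
        = 1 - t\<^sup>2 / 2 * transfer (\<lambda>z. (\<xi> z)\<^sup>2) x - t\<^sup>2 / 2 * transfer \<psi> x"
      by (simp only:) (simp add: field_simps)
    then show ?thesis using mart[OF x] by (simp only: of_real_diff of_real_1) simp
  qed
  finally have p: "transfer p x = of_real (1 - t\<^sup>2 / 2 * s - t\<^sup>2 / 2 * \<psi> x)" .
  have "cmod (transfer (\<lambda>y. iexp (t * \<xi> y) * of_real (1 - t\<^sup>2 / 2 * \<psi> y)) x - transfer p x)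
      \<le> (A ^ 3 + A\<^sup>2) * \<bar>t\<bar> ^ 3"
    unfolding transfer_diff[symmetric] by (rule norm_transfer_le[OF x]) (rule err[OF scons_inf_words[OF x]])
  moreover have "cmod (transfer p x - of_real (exp (- s * t\<^sup>2 / 2) * (1 - t\<^sup>2 / 2 * \<psi> x)))
      \<le> (s\<^sup>2 + s * A) * \<bar>t\<bar> ^ 3"
  proof -
    define u where "u = s * t\<^sup>2 / 2"
    have u: "0 \<le> u" using s by (simp add: u_def)
    have "1 - t\<^sup>2 / 2 * s - t\<^sup>2 / 2 * \<psi> x - exp (- u) * (1 - t\<^sup>2 / 2 * \<psi> x)
        = - (exp (- u) - (1 - u)) + (exp (- u) - 1) * (t\<^sup>2 / 2 * \<psi> x)"
      by (simp add: u_def algebra_simps)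
    also have "\<bar>\<dots>\<bar> \<le> u\<^sup>2 + u * (t\<^sup>2 / 2 * A)"
    proof (intro order.trans[OF abs_triangle_ineq] add_mono)
      show "\<bar>(exp (- u) - 1) * (t\<^sup>2 / 2 * \<psi> x)\<bar> \<le> u * (t\<^sup>2 / 2 * A)"
        unfolding abs_mult using exp_minus_approx(2)[OF u] A(3)[OF x] u
        by (intro mult_mono) (auto simp: intro!: mult_nonneg_nonneg)
    qed (use exp_minus_approx(1)[OF u] in simp)
    also have "\<dots> = (s\<^sup>2 / 4 + s * A / 4) * t ^ 4"
      by (simp add: u_def power2_eq_square eval_nat_numeral algebra_simps)
    also have "\<dots> \<le> (s\<^sup>2 + s * A) * \<bar>t\<bar> ^ 3"
      using s A(1) t4 by (intro mult_mono add_mono) auto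
    finally show ?thesis
      unfolding p of_real_diff[symmetric] norm_of_real by (simp add: u_def)
  qed
  ultimately show ?thesis
    using norm_triangle_le[of "transfer (\<lambda>y. iexp (t * \<xi> y) * of_real (1 - t\<^sup>2 / 2 * \<psi> y)) x - transfer p x"
        "transfer p x - of_real (exp (- s * t\<^sup>2 / 2) * (1 - t\<^sup>2 / 2 * \<psi> x))"
        "(A ^ 3 + A\<^sup>2 + s\<^sup>2 + s * A) * \<bar>t\<bar> ^ 3"]
    by (simp add: algebra_simps)
qed

text \<open>
  The errors of the single steps add up, since the twisted operators do not increase the supremum norm and
  the approximate eigenvalue is at most \<open>1\<close>. Passing between the constant \<open>1\<close> and the approximate
  eigenfunction costs \<open>A * t\<^sup>2 / 2\<close> at either end.
\<close>

lemma twisted_transfer_pow_estimate: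
  fixes \<xi> \<psi> :: "'a::finite letter_seq \<Rightarrow> real"
  assumes A: "0 \<le> A" "\<And>y. y \<in> inf_words \<Longrightarrow> \<bar>\<xi> y\<bar> \<le> A" "\<And>y. y \<in> inf_words \<Longrightarrow> \<bar>\<psi> y\<bar> \<le> A"
    and mart: "\<And>y. y \<in> inf_words \<Longrightarrow> transfer \<xi> y = 0"
    and pois: "\<And>y. y \<in> inf_words \<Longrightarrow> \<psi> y - transfer \<psi> y = transfer (\<lambda>z. (\<xi> z)\<^sup>2) y - s"
    and s: "0 \<le> s" and t: "\<bar>t\<bar> \<le> 1" and x: "x \<in> inf_words"
  shows "cmod ((transfer ^^ n) (\<lambda>y. iexp (t * birkhoff_sum \<xi> n y)) x - of_real (exp (- s * t\<^sup>2 / 2 * n)))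
     \<le> (A ^ 3 + A\<^sup>2 + s\<^sup>2 + s * A) * (real n * \<bar>t\<bar> ^ 3) + A * t\<^sup>2"
proof -
  define C where "C = (A ^ 3 + A\<^sup>2 + s\<^sup>2 + s * A) * \<bar>t\<bar> ^ 3"
  define h where "h y = complex_of_real (1 - t\<^sup>2 / 2 * \<psi> y)" for y
  define \<rho> where "\<rho> = exp (- s * t\<^sup>2 / 2)"
  have l: "0 \<le> \<rho>" "\<rho> \<le> 1" using s by (auto simp: \<rho>_def)
  define E where "E n y = iexp (t * birkhoff_sum \<xi> n y)" for n y
  have E1: "cmod (E n y) = 1" for n y by (simp add: E_def)
  have main: "cmod ((transfer ^^ n) (\<lambda>y. E n y * h y) x - of_real (\<rho> ^ n) * h x) \<le> real n * C"
    if "x \<in> inf_words" for x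
    using that
  proof (induction n arbitrary: x)
    case 0
    then show ?case by (simp add: E_def)
  next
    case (Suc n)
    define r where "r y = transfer (\<lambda>y. iexp (t * \<xi> y) * h y) y - of_real \<rho> * h y" for y
    have r: "cmod (r y) \<le> C" if "y \<in> inf_words" for y
      using twisted_transfer_one_step[OF A mart pois s t that] by (simp add: r_def C_def h_def \<rho>_def)
    have "(transfer ^^ Suc n) (\<lambda>y. E (Suc n) y * h y) x
        = (transfer ^^ n) (\<lambda>y. of_real \<rho> * (E n y * h y) + E n y * r y) x"
      unfolding E_def twisted_transfer_step[OF Suc.prems] by (simp add: r_def algebra_simps)
    also have "\<dots> = of_real \<rho> * (transfer ^^ n) (\<lambda>y. E n y * h y) x + (transfer ^^ n) (\<lambda>y. E n y * r y) x"
      by (simp add: transfer_pow_add transfer_pow_mult_left)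
    finally have eq: "(transfer ^^ Suc n) (\<lambda>y. E (Suc n) y * h y) x - of_real (\<rho> ^ Suc n) * h x
        = of_real \<rho> * ((transfer ^^ n) (\<lambda>y. E n y * h y) x - of_real (\<rho> ^ n) * h x)
          + (transfer ^^ n) (\<lambda>y. E n y * r y) x"
      by (simp add: algebra_simps)
    have "cmod (of_real \<rho> * ((transfer ^^ n) (\<lambda>y. E n y * h y) x - of_real (\<rho> ^ n) * h x)) \<le> 1 * (real n * C)"
      unfolding norm_mult using l Suc by (intro mult_mono) auto
    moreover have "cmod ((transfer ^^ n) (\<lambda>y. E n y * r y) x) \<le> C"
      by (rule norm_transfer_pow_le[OF Suc.prems]) (simp add: norm_mult E1 r)
    ultimately show ?case
      unfolding eq by (intro order.trans[OF norm_triangle_ineq]) (simp add: algebra_simps)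
  qed
  have h1: "cmod (1 - h y) \<le> t\<^sup>2 / 2 * A" if "y \<in> inf_words" for y
  proof -
    have "cmod (1 - h y) = t\<^sup>2 / 2 * \<bar>\<psi> y\<bar>"
    proof -
      have "1 - h y = of_real (t\<^sup>2 / 2 * \<psi> y)" by (simp add: h_def)
      then show ?thesis unfolding norm_of_real by (simp only: norm_of_real) (simp add: abs_mult)
    qed
    then show ?thesis using A(3)[OF that] by (simp add: mult_left_mono)
  qed
  have 1: "cmod ((transfer ^^ n) (E n) x - (transfer ^^ n) (\<lambda>y. E n y * h y) x) \<le> t\<^sup>2 / 2 * A"
  proof (rule norm_transfer_pow_diff_le[OF x])
    fix y :: "'a letter_seq" assume "y \<in> inf_words"
    moreover have "E n y - E n y * h y = E n y * (1 - h y)" by (simp add: algebra_simps)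
    ultimately show "cmod (E n y - E n y * h y) \<le> t\<^sup>2 / 2 * A"
      using h1 by (simp add: norm_mult E1)
  qed
  have 2: "cmod (of_real (\<rho> ^ n) * h x - of_real (\<rho> ^ n)) \<le> t\<^sup>2 / 2 * A"
  proof -
    have "of_real (\<rho> ^ n) * h x - of_real (\<rho> ^ n) = - of_real (\<rho> ^ n) * (1 - h x)"
      by (simp add: algebra_simps)
    also have "cmod \<dots> \<le> 1 * (t\<^sup>2 / 2 * A)"
      unfolding norm_mult using l h1[OF x] by (intro mult_mono) (auto simp: norm_power power_le_one)
    finally show ?thesis by simp
  qed
  have "\<rho> ^ n = exp (- s * t\<^sup>2 / 2 * n)"
    by (simp add: \<rho>_def exp_of_nat2_mult[symmetric])
  moreover have "cmod ((transfer ^^ n) (E n) x - of_real (\<rho> ^ n)) \<le> real n * C + A * t\<^sup>2"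
    using norm_triangle_le[OF add_mono[OF norm_triangle_le[OF add_mono[OF 1 main[OF x]] ] 2]] 
    by (simp add: algebra_simps)
  ultimately show ?thesis
    by (simp add: E_def[abs_def] C_def mult_ac)
qed

context max_entropy_shift
begin

section \<open>The asymptotic variance\<close>

text \<open>
  The summands \<open>\<xi> \<circ> \<sigma>\<^sup>i\<close> are orthogonal: expanding the square and applying \<open>transfer\<close>, which preserves
  integrals, the mixed term acquires the factor \<open>transfer \<xi> = 0\<close>.
\<close>

lemma integral_birkhoff_square:
  assumes h: "hoelder \<beta> \<xi>" and mart: "\<And>x. x \<in> inf_words \<Longrightarrow> transfer \<xi> x = 0"
  shows "(\<integral>x. (birkhoff_sum \<xi> n x)\<^sup>2 \<partial>\<mu>) = real n * (\<integral>x. (\<xi> x)\<^sup>2 \<partial>\<mu>)"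
proof (induction n)
  case (Suc n)
  have sq: "hoelder \<beta> (\<lambda>x. (g x)\<^sup>2)" if "hoelder \<beta> g" for g :: "'a letter_seq \<Rightarrow> real"
    using hoelder_mult[OF beta_pos(2) that that] by (simp add: power2_eq_square)
  have S: "hoelder \<beta> (birkhoff_sum \<xi> n)" for n
    by (rule hoelder_birkhoff_sum[OF beta_pos(1) beta_less h])
  have "(\<integral>x. (birkhoff_sum \<xi> (Suc n) x)\<^sup>2 \<partial>\<mu>) = (\<integral>x. transfer (\<lambda>x. (birkhoff_sum \<xi> (Suc n) x)\<^sup>2) x \<partial>\<mu>)"
    by (rule integral_transfer[OF sq[OF S], symmetric])
  also have "\<dots> = (\<integral>x. transfer (\<lambda>x. (\<xi> x)\<^sup>2) x + (birkhoff_sum \<xi> n x)\<^sup>2 \<partial>\<mu>)"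
  proof (rule Bochner_Integration.integral_cong[OF refl])
    fix x assume "x \<in> space \<mu>"
    then have x: "x \<in> inf_words" by (simp add: space_mu)
    have "(\<lambda>y. (birkhoff_sum \<xi> (Suc n) y)\<^sup>2) = (\<lambda>y. ((\<xi> y)\<^sup>2
        + birkhoff_sum \<xi> n (seq_shift y) * (2 * \<xi> y)) + (birkhoff_sum \<xi> n (seq_shift y))\<^sup>2)"
      by (rule ext) (simp add: birkhoff_sum_Suc power2_eq_square algebra_simps)
    then show "transfer (\<lambda>y. (birkhoff_sum \<xi> (Suc n) y)\<^sup>2) x
        = transfer (\<lambda>x. (\<xi> x)\<^sup>2) x + (birkhoff_sum \<xi> n x)\<^sup>2"
      by (simp only: transfer_add transfer_mult_left mart[OF x]
          transfer_mult_shift[of "birkhoff_sum \<xi> n" "\<lambda>y. 2 * \<xi> y" x]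
          transfer_shift[OF x, of "\<lambda>y. (birkhoff_sum \<xi> n y)\<^sup>2"]
          mult_zero_right add_0_right)
  qed
  also have "\<dots> = (\<integral>x. (\<xi> x)\<^sup>2 \<partial>\<mu>) + (\<integral>x. (birkhoff_sum \<xi> n x)\<^sup>2 \<partial>\<mu>)"
    using sq[OF h] sq[OF S]
    by (simp add: Bochner_Integration.integral_add hoelder_integrable hoelder_transfer integral_transfer)
  finally show ?case using Suc by (simp add: algebra_simps)
qed simp

text \<open>
  The coboundary changes the Birkhoff sums \<open>a\<close> of \<open>\<xi>\<close> by some \<open>b\<close> with \<open>|b| \<le> 2 * A\<close>. The mixed term
  is controlled by \<open>2 |a b| \<le> a\<^sup>2 / sqrt n + sqrt n * b\<^sup>2\<close>, whose integral is of order \<open>sqrt n\<close>.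
\<close>

lemma variance_seq_tendsto:
  assumes f: "hoelder \<beta> f" and xi: "hoelder \<beta> \<xi>" and u: "hoelder \<beta> u"
    and mart: "\<And>x. x \<in> inf_words \<Longrightarrow> transfer \<xi> x = 0"
    and dec: "\<And>x. x \<in> inf_words \<Longrightarrow> f x - (\<integral>y. f y \<partial>\<mu>) = \<xi> x + u (seq_shift x) - u x"
  shows "variance_seq \<mu> f \<longlonglongrightarrow> (\<integral>x. (\<xi> x)\<^sup>2 \<partial>\<mu>)"
proof -
  define c s where "c = (\<integral>y. f y \<partial>\<mu>)" and "s = (\<integral>x. (\<xi> x)\<^sup>2 \<partial>\<mu>)"
  obtain A where A: "0 < A" "\<And>x. x \<in> inf_words \<Longrightarrow> \<bar>u x\<bar> \<le> A"
    using hoelder_bounded[OF u] by blast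
  have sq: "hoelder \<beta> (\<lambda>x. (g x)\<^sup>2)" if "hoelder \<beta> g" for g :: "'a letter_seq \<Rightarrow> real"
    using hoelder_mult[OF beta_pos(2) that that] by (simp add: power2_eq_square)
  have i1: "integrable \<mu> (\<lambda>x. (birkhoff_sum \<xi> n x)\<^sup>2)" for n
    by (rule hoelder_integrable[OF sq[OF hoelder_birkhoff_sum[OF beta_pos(1) beta_less xi]]])
  have i2: "integrable \<mu> (\<lambda>x. (birkhoff_sum f n x - real n * c)\<^sup>2)" for n
    by (rule hoelder_integrable[OF sq[OF hoelder_diff[OF beta_pos(2)
            hoelder_birkhoff_sum[OF beta_pos(1) beta_less f] hoelder_const[OF beta_pos(2)]]]])
  have bound: "\<bar>variance_seq \<mu> f n - s\<bar> \<le> (s + 4 * A\<^sup>2) / sqrt (real n) + 4 * A\<^sup>2 / real n" if n: "0 < n" for n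
  proof -
    define r where "r = sqrt (real n)"
    have r: "r > 0" "r * r = real n" using n by (auto simp: r_def)
    have "\<bar>(birkhoff_sum f n x - real n * c)\<^sup>2 - (birkhoff_sum \<xi> n x)\<^sup>2\<bar>
        \<le> (birkhoff_sum \<xi> n x)\<^sup>2 / r + (r * (4 * A\<^sup>2) + 4 * A\<^sup>2)" if x: "x \<in> inf_words" for x
    proof -
      define a b where "a = birkhoff_sum \<xi> n x" and "b = u ((seq_shift ^^ n) x) - u x"
      have "\<bar>b\<bar> \<le> 2 * A"
        using A(2)[OF x] A(2)[OF funpow_shift_inf_words[OF x, of n]] by (simp add: b_def)
      then have b: "b\<^sup>2 \<le> 4 * A\<^sup>2"
        using power_mono[of "\<bar>b\<bar>" "2 * A" 2] by (simp add: power_mult_distrib)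
      \<comment> \<open>Young's inequality with weight \<open>r = sqrt n\<close>\<close>
      have "0 \<le> (\<bar>a\<bar> / sqrt r - sqrt r * \<bar>b\<bar>)\<^sup>2" by simp
      also have "\<dots> = a\<^sup>2 / r + r * b\<^sup>2 - 2 * (\<bar>a\<bar> * \<bar>b\<bar>)"
        using r by (simp add: power2_diff power_divide power_mult_distrib)
      finally have ab: "2 * (\<bar>a\<bar> * \<bar>b\<bar>) \<le> a\<^sup>2 / r + r * b\<^sup>2" by simp
      have "birkhoff_sum f n x - real n * c = a + b"
        using birkhoff_sum_coboundary[OF x, of f c \<xi> u n] dec by (simp add: a_def b_def c_def)
      then have "(birkhoff_sum f n x - real n * c)\<^sup>2 - (birkhoff_sum \<xi> n x)\<^sup>2 = 2 * (a * b) + b\<^sup>2"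
        by (simp add: a_def[symmetric] power2_sum)
      also have "\<bar>\<dots>\<bar> \<le> 2 * (\<bar>a\<bar> * \<bar>b\<bar>) + b\<^sup>2"
        by (intro order.trans[OF abs_triangle_ineq]) (simp add: abs_mult)
      also have "\<dots> \<le> a\<^sup>2 / r + r * b\<^sup>2 + b\<^sup>2" using ab by simp
      also have "\<dots> \<le> a\<^sup>2 / r + r * (4 * A\<^sup>2) + 4 * A\<^sup>2"
        using b r by (intro add_mono mult_left_mono) auto
      finally show ?thesis by (simp add: a_def)
    qed
    then have "\<bar>\<integral>x. (birkhoff_sum f n x - real n * c)\<^sup>2 - (birkhoff_sum \<xi> n x)\<^sup>2 \<partial>\<mu>\<bar>
        \<le> (\<integral>x. (birkhoff_sum \<xi> n x)\<^sup>2 / r + (r * (4 * A\<^sup>2) + 4 * A\<^sup>2) \<partial>\<mu>)"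
      using i1 i2 by (intro order.trans[OF integral_abs_bound integral_mono]) (auto simp: space_mu)
    also have "\<dots> = real n * s / r + (r * (4 * A\<^sup>2) + 4 * A\<^sup>2)"
      using i1[of n] integral_birkhoff_square[OF xi mart, of n]
      by (simp add: Bochner_Integration.integral_add prob_space s_def)
    finally have "\<bar>(\<integral>x. (birkhoff_sum f n x - real n * c)\<^sup>2 \<partial>\<mu>) - real n * s\<bar>
        \<le> real n * s / r + (r * (4 * A\<^sup>2) + 4 * A\<^sup>2)"
      using i1[of n] i2[of n] integral_birkhoff_square[OF xi mart, of n]
      by (simp add: Bochner_Integration.integral_diff s_def)
    moreover have "variance_seq \<mu> f n - s = ((\<integral>x. (birkhoff_sum f n x - real n * c)\<^sup>2 \<partial>\<mu>) - real n * s) / real n"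
      using n by (simp add: variance_seq_def c_def field_simps)
    ultimately have "\<bar>variance_seq \<mu> f n - s\<bar> \<le> (real n * s / r + (r * (4 * A\<^sup>2) + 4 * A\<^sup>2)) / real n"
      using n by (simp add: abs_divide divide_right_mono)
    also have "\<dots> = (s + 4 * A\<^sup>2) / r + 4 * A\<^sup>2 / real n"
      using r(1) unfolding r(2)[symmetric] by (simp add: field_simps)
    finally show ?thesis by (simp add: r_def)
  qed
  have "(\<lambda>n. (s + 4 * A\<^sup>2) / sqrt (real n) + 4 * A\<^sup>2 / real n) \<longlonglongrightarrow> 0"
    by real_asymp
  then have "(\<lambda>n. variance_seq \<mu> f n - s) \<longlonglongrightarrow> 0"
    by (rule Lim_null_comparison[rotated]) (use bound in \<open>auto intro: eventually_sequentiallyI[of 1]\<close>)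
  then show ?thesis by (simp add: LIM_zero_iff s_def)
qed

text \<open>
  A positive value at \<open>x\<close> forces, by continuity, a positive lower bound on a cylinder around \<open>x\<close>, and
  cylinders have positive mass.
\<close>

lemma hoelder_nonneg_integral_0:
  assumes h: "hoelder \<beta> h" and nonneg: "\<And>x. x \<in> inf_words \<Longrightarrow> 0 \<le> h x" and 0: "(\<integral>x. h x \<partial>\<mu>) = 0"
    and x: "x \<in> inf_words"
  shows "h x = 0"
proof (rule ccontr)
  assume "h x \<noteq> 0"
  with nonneg[OF x] have pos: "h x > 0" by simp
  obtain K where K: "hoelder_with K \<beta> inf_words h" using h by (auto simp: hoelder_def)
  have "\<forall>\<^sub>F n in sequentially. K * \<beta> ^ Suc n < h x / 2"
    using order_tendstoD(2)[OF LIMSEQ_Suc[OF tendsto_beta_pow[of K]], of "h x / 2"] pos by simp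
  then obtain n where n: "K * \<beta> ^ Suc n < h x / 2"
    by (auto simp: eventually_sequentially)
  obtain w where w: "w \<in> words (Suc n)" "x \<in> cylinder w"
    using prefix_cylinder[OF x] by blast
  have "h x / 2 * indicator (cylinder w) y \<le> h y" if y: "y \<in> inf_words" for y
  proof (cases "y \<in> cylinder w")
    case True
    have "\<bar>h x - h y\<bar> \<le> K * \<beta> ^ Suc n"
      by (rule hoelder_withD[OF K x y]) (use w True in \<open>auto simp: cylinder_def words_def\<close>)
    then show ?thesis using n True by simp
  qed (use nonneg[OF y] in simp)
  then have le: "(\<integral>y. h x / 2 * indicator (cylinder w) y \<partial>\<mu>) \<le> (\<integral>y. h y \<partial>\<mu>)"
    using cylinder_sets[OF w(1)] hoelder_integrable[OF h]
    by (intro integral_mono) (auto simp: space_mu emeasure_eq_measure)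
  have eq: "(\<integral>y. h x / 2 * indicator (cylinder w) y \<partial>\<mu>) = h x / 2 * prob (cylinder w)"
    using sets.Int_space_eq2[OF cylinder_sets[OF w(1)]] by simp
  have "prob (cylinder w) > 0"
    using measure_cylinder[OF w(1)] q_ge by simp
  then have "0 < h x / 2 * prob (cylinder w)" using pos by simp
  then show False using le unfolding eq 0 by simp
qed

section \<open>Characteristic functions with a restricted first letter\<close>

definition starts_in :: "'a letter set \<Rightarrow> 'a letter_seq \<Rightarrow> real" where
  "starts_in B x = (if x 0 \<in> Some ` B then 1 else 0)"

lemma hoelder_with_starts_in: "hoelder_with 1 \<beta> inf_words (starts_in B)"
proof (rule hoelder_withI)
  fix x y :: "'a letter_seq" and N assume "\<And>i. i < N \<Longrightarrow> x i = y i"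
  then show "\<bar>starts_in B x - starts_in B y\<bar> \<le> 1 * \<beta> ^ N"
    by (cases N) (auto simp: starts_in_def)
qed

lemma integral_starts_in:
  assumes "B \<noteq> {}"
  shows "0 < (\<integral>x. starts_in B x \<partial>\<mu>)" "(\<integral>x. starts_in B x \<partial>\<mu>) \<le> 1"
proof -
  have h: "hoelder \<beta> (starts_in B)" using hoelder_with_starts_in by (auto simp: hoelder_def)
  have "(\<integral>x. starts_in B x \<partial>\<mu>) \<noteq> 0"
  proof
    assume 0: "(\<integral>x. starts_in B x \<partial>\<mu>) = 0"
    obtain c where c: "c \<in> B" using assms by blast
    have "starts_in B (\<lambda>_. Some c) = 0"
      by (rule hoelder_nonneg_integral_0[OF h _ 0]) (auto simp: starts_in_def)
    then show False using c by (simp add: starts_in_def)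
  qed
  moreover have "0 \<le> (\<integral>x. starts_in B x \<partial>\<mu>)"
    by (intro integral_nonneg_AE) (auto simp: starts_in_def)
  ultimately show "0 < (\<integral>x. starts_in B x \<partial>\<mu>)" by simp
  have "(\<integral>x. starts_in B x \<partial>\<mu>) \<le> (\<integral>x. 1 \<partial>\<mu>)"
    by (intro integral_mono hoelder_integrable h) (auto simp: starts_in_def)
  then show "(\<integral>x. starts_in B x \<partial>\<mu>) \<le> 1" by (simp add: prob_space)
qed

text \<open>
  Dropping the first \<open>j\<close> terms of the Birkhoff sum changes the exponential little. Afterwards the
  restriction of the first letter is seen only through its image under \<open>j\<close> steps of the operator, which
  is nearly constant.
\<close>

lemma twisted_transfer_first_letter:
  assumes A: "\<And>y. y \<in> inf_words \<Longrightarrow> \<bar>\<xi> y\<bar> \<le> A" and x: "x \<in> inf_words" and B: "B \<noteq> {}"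
  shows "cmod ((transfer ^^ (j + n)) (\<lambda>y. iexp (t * birkhoff_sum \<xi> (j + n) y) * of_real (starts_in B y)) x
      - of_real (\<integral>y. starts_in B y \<partial>\<mu>) * (transfer ^^ (j + n)) (\<lambda>y. iexp (t * birkhoff_sum \<xi> (j + n) y)) x)
    \<le> 2 * (\<bar>t\<bar> * (real j * A)) + 3 * \<beta> ^ j"
proof -
  define G where "G y = iexp (t * birkhoff_sum \<xi> n y)" for y
  define E where "E y = iexp (t * birkhoff_sum \<xi> (j + n) y)" for y
  define b where "b = (\<integral>y. starts_in B y \<partial>\<mu>)"
  have b: "0 \<le> b" "b \<le> 1" using integral_starts_in[OF B] by (auto simp: b_def)
  have EG: "cmod (E y - G ((seq_shift ^^ j) y)) \<le> \<bar>t\<bar> * (real j * A)" if "y \<in> inf_words" for y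
  proof -
    have "cmod (E y - G ((seq_shift ^^ j) y))
        \<le> \<bar>t * birkhoff_sum \<xi> (j + n) y - t * birkhoff_sum \<xi> n ((seq_shift ^^ j) y)\<bar>"
      unfolding E_def G_def by (rule iexp_lipschitz)
    also have "\<dots> = \<bar>t\<bar> * \<bar>birkhoff_sum \<xi> j y\<bar>"
      by (simp add: birkhoff_sum_add algebra_simps flip: abs_mult)
    also have "\<dots> \<le> \<bar>t\<bar> * (real j * A)"
      using birkhoff_sum_bound[OF that A] by (intro mult_left_mono) auto
    finally show ?thesis .
  qed
  have pull: "(transfer ^^ (j + n)) (\<lambda>y. G ((seq_shift ^^ j) y) * h y) x
      = (transfer ^^ n) (\<lambda>y. G y * (transfer ^^ j) h y) x" for h
    unfolding add.commute[of j n] funpow_add comp_def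
    by (rule transfer_pow_cong[OF x]) (rule transfer_pow_mult_shift)
  have 1: "cmod ((transfer ^^ (j + n)) (\<lambda>y. E y * of_real (starts_in B y)) x
      - (transfer ^^ (j + n)) (\<lambda>y. G ((seq_shift ^^ j) y) * of_real (starts_in B y)) x) \<le> \<bar>t\<bar> * (real j * A)"
  proof (rule norm_transfer_pow_diff_le[OF x])
    fix y :: "'a letter_seq" assume "y \<in> inf_words"
    from EG[OF this]
    show "cmod (E y * of_real (starts_in B y) - G ((seq_shift ^^ j) y) * of_real (starts_in B y))
        \<le> \<bar>t\<bar> * (real j * A)"
      using norm_ge_zero[of "E y - G ((seq_shift ^^ j) y)"]
      by (auto simp: starts_in_def simp del: norm_ge_zero)
  qed
  have 2: "cmod ((transfer ^^ n) (\<lambda>y. G y * (transfer ^^ j) (\<lambda>y. of_real (starts_in B y)) y) x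
      - (transfer ^^ n) (\<lambda>y. of_real b * G y) x) \<le> 3 * \<beta> ^ j"
  proof (rule norm_transfer_pow_diff_le[OF x])
    fix y :: "'a letter_seq" assume y: "y \<in> inf_words"
    have "G y * (transfer ^^ j) (\<lambda>y. of_real (starts_in B y)) y - of_real b * G y
        = G y * of_real ((transfer ^^ j) (starts_in B) y - b)"
      by (simp add: transfer_pow_of_real algebra_simps)
    also have "cmod \<dots> = \<bar>(transfer ^^ j) (starts_in B) y - b\<bar>"
      unfolding norm_mult norm_of_real by (simp add: G_def)
    also have "\<dots> \<le> 3 * \<beta> ^ j"
      using transfer_pow_tends_to_mean[OF hoelder_with_starts_in y] by (simp add: b_def)
    finally show "cmod (G y * (transfer ^^ j) (\<lambda>y. of_real (starts_in B y)) y - of_real b * G y) \<le> 3 * \<beta> ^ j" .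
  qed
  have 3: "cmod ((transfer ^^ n) (\<lambda>y. of_real b * G y) x - of_real b * (transfer ^^ (j + n)) E x)
      \<le> \<bar>t\<bar> * (real j * A)"
  proof -
    have "(transfer ^^ n) G x = (transfer ^^ n) (\<lambda>y. G y * (transfer ^^ j) (\<lambda>_. 1) y) x"
      by (rule transfer_pow_cong[OF x]) (simp add: transfer_pow_const)
    also have "\<dots> = (transfer ^^ (j + n)) (\<lambda>y. G ((seq_shift ^^ j) y)) x"
      using pull[of "\<lambda>_. 1"] by simp
    finally have "(transfer ^^ n) (\<lambda>y. of_real b * G y) x - of_real b * (transfer ^^ (j + n)) E x
        = of_real b * ((transfer ^^ (j + n)) (\<lambda>y. G ((seq_shift ^^ j) y)) x - (transfer ^^ (j + n)) E x)"
      by (simp add: transfer_pow_mult_left right_diff_distrib)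
    also have "cmod \<dots> \<le> 1 * (\<bar>t\<bar> * (real j * A))"
      unfolding norm_mult using b
      by (intro mult_mono norm_transfer_pow_diff_le[OF x]) (auto simp: norm_minus_commute EG)
    finally show ?thesis by simp
  qed
  have "cmod ((transfer ^^ (j + n)) (\<lambda>y. E y * of_real (starts_in B y)) x - of_real b * (transfer ^^ (j + n)) E x)
      \<le> \<bar>t\<bar> * (real j * A) + 3 * \<beta> ^ j + \<bar>t\<bar> * (real j * A)"
    using norm_triangle_le[OF add_mono[OF norm_triangle_le[OF add_mono[OF 1[unfolded pull] 2]] 3]] by simp
  then show ?thesis by (simp add: E_def[abs_def] b_def mult_ac)
qed

text \<open>
  The central limit theorem in terms of characteristic functions: \<open>t n\<close> is the frequency divided by the
  normalisation, and \<open>\<tau>\<close> is the limit of the number of steps times its square.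
\<close>

lemma transfer_clt:
  assumes xi: "hoelder \<beta> \<xi>" and mart: "\<And>x. x \<in> inf_words \<Longrightarrow> transfer \<xi> x = 0"
    and x: "x \<in> inf_words" and B: "B \<noteq> {}"
    and t0: "t \<longlonglongrightarrow> 0" and t2: "(\<lambda>n. real n * (t n)\<^sup>2) \<longlonglongrightarrow> \<tau>"
  shows "(\<lambda>n. (transfer ^^ n) (\<lambda>y. iexp (t n * birkhoff_sum \<xi> n y) * of_real (starts_in B y)) x)
    \<longlonglongrightarrow> of_real (\<integral>y. starts_in B y \<partial>\<mu>) * of_real (exp (- (\<integral>y. (\<xi> y)\<^sup>2 \<partial>\<mu>) * \<tau> / 2))"
proof -
  define s where "s = (\<integral>y. (\<xi> y)\<^sup>2 \<partial>\<mu>)"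
  define b where "b = (\<integral>y. starts_in B y \<partial>\<mu>)"
  have s: "0 \<le> s" by (simp add: s_def)
  have sq: "hoelder \<beta> (\<lambda>y. (\<xi> y)\<^sup>2)"
    using hoelder_mult[OF beta_pos(2) xi xi] by (simp add: power2_eq_square)
  have V: "hoelder \<beta> (\<lambda>y. transfer (\<lambda>z. (\<xi> z)\<^sup>2) y - s)"
    by (intro hoelder_diff hoelder_transfer sq) auto
  have "(\<integral>y. transfer (\<lambda>z. (\<xi> z)\<^sup>2) y - s \<partial>\<mu>) = 0"
    using hoelder_integrable[OF hoelder_transfer[OF sq]]
    by (simp add: integral_transfer[OF sq] prob_space s_def)
  from poisson_equation[OF V this] obtain \<psi> where \<psi>: "hoelder \<beta> \<psi>"
    "\<And>y. y \<in> inf_words \<Longrightarrow> \<psi> y - transfer \<psi> y = transfer (\<lambda>z. (\<xi> z)\<^sup>2) y - s" by blast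
  obtain A1 A2 where A12: "\<And>y. y \<in> inf_words \<Longrightarrow> \<bar>\<xi> y\<bar> \<le> A1" "\<And>y. y \<in> inf_words \<Longrightarrow> \<bar>\<psi> y\<bar> \<le> A2" "0 < A1" "0 < A2"
    using hoelder_bounded[OF xi] hoelder_bounded[OF \<psi>(1)] by blast
  define A where "A = A1 + A2"
  have A: "0 \<le> A" "\<And>y. y \<in> inf_words \<Longrightarrow> \<bar>\<xi> y\<bar> \<le> A" "\<And>y. y \<in> inf_words \<Longrightarrow> \<bar>\<psi> y\<bar> \<le> A"
    using A12 by (force simp: A_def)+
  define C where "C = A ^ 3 + A\<^sup>2 + s\<^sup>2 + s * A"
  define P where "P n = (transfer ^^ n) (\<lambda>y. iexp (t n * birkhoff_sum \<xi> n y)) x" for n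
  define Q where "Q n = (transfer ^^ n) (\<lambda>y. iexp (t n * birkhoff_sum \<xi> n y) * of_real (starts_in B y)) x" for n
  have "P \<longlonglongrightarrow> of_real (exp (- s * \<tau> / 2))"
  proof -
    have ev: "\<forall>\<^sub>F n in sequentially. \<bar>t n\<bar> \<le> 1"
      using tendstoD[OF t0, of 1] by (auto elim!: eventually_mono simp: dist_real_def)
    have "(\<lambda>n. C * (real n * (t n)\<^sup>2 * \<bar>t n\<bar>) + A * (t n)\<^sup>2) \<longlonglongrightarrow> C * (\<tau> * \<bar>0\<bar>) + A * 0\<^sup>2"
      by (intro tendsto_intros t2 t0)
    then have lim: "(\<lambda>n. C * (real n * (t n)\<^sup>2 * \<bar>t n\<bar>) + A * (t n)\<^sup>2) \<longlonglongrightarrow> 0" by simp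
    have "(\<lambda>n. P n - of_real (exp (- s * (t n)\<^sup>2 / 2 * n))) \<longlonglongrightarrow> 0"
    proof (rule Lim_null_comparison[OF _ lim], rule eventually_mono[OF ev])
      fix n assume "\<bar>t n\<bar> \<le> 1"
      from twisted_transfer_pow_estimate[OF A mart \<psi>(2) s this x, of n]
      show "cmod (P n - of_real (exp (- s * (t n)\<^sup>2 / 2 * n))) \<le> C * (real n * (t n)\<^sup>2 * \<bar>t n\<bar>) + A * (t n)\<^sup>2"
        by (simp add: P_def C_def power3_eq_cube power2_eq_square mult_ac)
    qed
    moreover have "(\<lambda>n. complex_of_real (exp (- s * (real n * (t n)\<^sup>2) / 2))) \<longlonglongrightarrow> of_real (exp (- s * \<tau> / 2))"
      by (intro tendsto_intros t2) auto
    ultimately have "(\<lambda>n. (P n - of_real (exp (- s * (t n)\<^sup>2 / 2 * n)))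
        + complex_of_real (exp (- s * (real n * (t n)\<^sup>2) / 2))) \<longlonglongrightarrow> 0 + of_real (exp (- s * \<tau> / 2))"
      by (rule tendsto_add)
    then show ?thesis by (simp add: mult_ac)
  qed
  moreover have "(\<lambda>n. Q n - of_real b * P n) \<longlonglongrightarrow> 0"
  proof (rule tendstoI)
    fix e :: real assume e: "0 < e"
    \<comment> \<open>fix the number \<open>j\<close> of dropped letters first, and let \<open>n\<close> grow afterwards\<close>
    have "\<forall>\<^sub>F j in sequentially. 3 * \<beta> ^ j < e / 2"
      using order_tendstoD(2)[OF tendsto_beta_pow[of 3], of "e / 2"] e by simp
    then obtain j where j: "3 * \<beta> ^ j < e / 2" by (auto simp: eventually_sequentially)
    have "(\<lambda>n. 2 * (\<bar>t n\<bar> * (real j * A))) \<longlonglongrightarrow> 2 * (\<bar>0\<bar> * (real j * A))"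
      by (intro tendsto_intros t0)
    then have "\<forall>\<^sub>F n in sequentially. 2 * (\<bar>t n\<bar> * (real j * A)) < e / 2"
      using order_tendstoD(2)[of "\<lambda>n. 2 * (\<bar>t n\<bar> * (real j * A))" 0 sequentially "e / 2"] e by simp
    then show "\<forall>\<^sub>F n in sequentially. dist (Q n - of_real b * P n) 0 < e"
      using eventually_ge_at_top[of j]
    proof eventually_elim
      case (elim n)
      then obtain m where m: "n = j + m" by (auto simp: le_iff_add)
      have "cmod (Q n - of_real b * P n) \<le> 2 * (\<bar>t n\<bar> * (real j * A)) + 3 * \<beta> ^ j"
        using twisted_transfer_first_letter[OF A(2) x B, where j = j and n = m and t = "t n"] unfolding Q_def P_def b_def m .
      then show ?case using elim j by simp
    qed
  qed
  ultimately have "(\<lambda>n. (Q n - of_real b * P n) + of_real b * P n) \<longlonglongrightarrow> 0 + of_real b * of_real (exp (- s * \<tau> / 2))"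
    by (intro tendsto_intros)
  then show ?thesis by (simp add: Q_def b_def s_def)
qed

end

section \<open>Conjugacy classes in the free group\<close>

definition word_inv :: "'a letter list \<Rightarrow> 'a letter list" where
  "word_inv w = rev (map letter_inv w)"

definition cyclically_reduced :: "'a letter list \<Rightarrow> bool" where
  "cyclically_reduced w \<longleftrightarrow> w \<noteq> [] \<and> reduced_word w \<and> hd w \<noteq> letter_inv (last w)"

lemma letter_inv_eq_iff [simp]: "letter_inv a = letter_inv b \<longleftrightarrow> a = b"
  by (metis letter_inv_letter_inv)

lemma word_inv_simps [simp]:
  "word_inv [] = []" "word_inv (w @ [l]) = letter_inv l # word_inv w" "word_inv w = [] \<longleftrightarrow> w = []"
  "length (word_inv w) = length w" "word_inv (word_inv w) = w"
  by (simp_all add: word_inv_def rev_map comp_def)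

lemma last_word_inv: "w \<noteq> [] \<Longrightarrow> last (word_inv w) = letter_inv (hd w)"
  by (cases w) (simp_all add: word_inv_def)

lemma reduced_word_inv [simp]: "reduced_word (word_inv w) \<longleftrightarrow> reduced_word w"
proof -
  have eq: "(\<lambda>a b :: 'a letter. b \<noteq> letter_inv a) = (\<lambda>a b. letter_inv a \<noteq> letter_inv (letter_inv b))"
    by (simp only: letter_inv_letter_inv eq_commute)
  have "reduced_word (word_inv w) = successively (\<lambda>a b. letter_inv a \<noteq> letter_inv (letter_inv b)) w"
    by (simp only: reduced_word_def word_inv_def successively_rev successively_map)
  also have "\<dots> = reduced_word w"
    unfolding reduced_word_def eq ..
  finally show ?thesis .
qed

lemma foldr_word_inv: "reduced_word w \<Longrightarrow> foldr letter_mult (word_inv w) w = []"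
proof (induction w)
  case (Cons l w)
  then have "reduced_word w" by (auto dest: reduced_ConsD)
  then show ?case using Cons.IH by (simp add: word_inv_def)
qed simp

lemma inv_free_group:
  assumes "reduced_word w"
  shows "inv\<^bsub>free_group\<^esub> w = word_inv w"
  by (rule group.inv_equality[OF group_free_group]) (use assms foldr_word_inv in simp_all)

lemma foldr_reduced_append: "reduced_word (v @ w) \<Longrightarrow> foldr letter_mult v w = v @ w"
proof (induction v)
  case (Cons l v)
  then show ?case using reduced_ConsD[of l "v @ w"] letter_mult_reduced[of l "v @ w"] by simp
qed simp

lemma foldr_single:
  assumes "reduced_word z"
  shows "foldr letter_mult z [c] = (if z \<noteq> [] \<and> last z = letter_inv c then butlast z else z @ [c])"
proof (cases z rule: rev_cases)
  case (snoc v d)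
  then have v: "reduced_word v" using assms by (simp add: reduced_append_iff)
  show ?thesis
  proof (cases "d = letter_inv c")
    case True
    then show ?thesis using snoc v by (simp add: foldr_letter_mult_Nil)
  next
    case False
    then have "c \<noteq> letter_inv d" by auto
    then show ?thesis using snoc assms False by (simp add: foldr_reduced_append)
  qed
qed simp

definition letter_conj :: "'a letter \<Rightarrow> 'a letter list \<Rightarrow> 'a letter list" where
  "letter_conj l z = letter_mult l (foldr letter_mult z [letter_inv l])"

definition core_decomposable :: "nat \<Rightarrow> 'a letter list \<Rightarrow> bool" where
  "core_decomposable k z \<longleftrightarrow>
     reduced_word z \<and> (\<exists>g w. z = word_inv w @ g @ w \<and> cyclically_reduced g \<and> length g = k)"

lemma core_decomposable_self:
  assumes "cyclically_reduced g"
  shows "core_decomposable (length g) g"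
proof -
  have "g = word_inv [] @ g @ []" by simp
  then show ?thesis
    using assms unfolding core_decomposable_def cyclically_reduced_def by blast
qed

text \<open>
  Conjugation by a letter lengthens or shortens the conjugating word \<open>w\<close> by a letter; when \<open>w\<close> is empty it
  may instead rotate the cyclically reduced core, which stays cyclically reduced.
\<close>

lemma core_decomposable_letter_conj:
  assumes "core_decomposable k z"
  shows "core_decomposable k (letter_conj l z)"
proof -
  obtain g w where z: "z = word_inv w @ g @ w" "reduced_word z" and g: "cyclically_reduced g" "length g = k"
    using assms by (auto simp: core_decomposable_def)
  have g': "g \<noteq> []" "reduced_word g" "hd g \<noteq> letter_inv (last g)"
    using g by (auto simp: cyclically_reduced_def)
  have rotated: ?thesis if "letter_conj l z = g2" "cyclically_reduced g2" "length g2 = length g" for g2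
    using core_decomposable_self[OF that(2)] that(1,3) g(2) by simp
  have conj: "letter_conj l z = letter_mult l (if last z = l then butlast z else z @ [letter_inv l])"
    using foldr_single[OF z(2)] z(1) g'(1) by (simp add: letter_conj_def)
  show ?thesis
  proof (cases w rule: rev_cases)
    case Nil
    then have zg: "z = g" using z by simp
    consider (l) "last g = l" | (f) "last g \<noteq> l" "hd g = letter_inv l" | (n) "last g \<noteq> l" "hd g \<noteq> letter_inv l"
      by blast
    then show ?thesis
    proof cases
      case l
      then obtain v where v: "g = v @ [l]" using g'(1) by (metis append_butlast_last_id)
      have "letter_conj l z = l # v"
        unfolding conj using g' by (cases v) (auto simp: zg v)
      moreover have "cyclically_reduced (l # v)"
      proof (cases "v = []")
        case False
        then have "reduced_word v" "l \<noteq> letter_inv (last v)" "hd v \<noteq> letter_inv l"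
          using g' by (auto simp: v reduced_append_iff)
        then show ?thesis
          using False reduced_append_iff[of "[l]" v] by (auto simp: cyclically_reduced_def)
      qed (simp add: cyclically_reduced_def)
      ultimately show ?thesis using rotated v by simp
    next
      case f
      then obtain v where v: "g = letter_inv l # v" using g'(1) by (cases g) auto
      have "letter_conj l z = v @ [letter_inv l]"
        unfolding conj using f by (simp add: zg v)
      moreover have "cyclically_reduced (v @ [letter_inv l])"
      proof (cases "v = []")
        case False
        then have "reduced_word v" "last v \<noteq> l" "hd v \<noteq> l"
          using g' f reduced_append_iff[of "[letter_inv l]" v] by (auto simp: v)
        then show ?thesis
          using False reduced_append_iff[of v "[letter_inv l]"] by (auto simp: cyclically_reduced_def)
      qed (simp add: cyclically_reduced_def)
      ultimately show ?thesis using rotated v by simp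
    next
      case n
      have eq: "letter_conj l z = word_inv [letter_inv l] @ g @ [letter_inv l]"
        unfolding conj using n g' by (cases g) (auto simp: zg word_inv_def)
      have "reduced_word (word_inv [letter_inv l] @ g @ [letter_inv l])"
        using n g' reduced_append_iff[of g "[letter_inv l]"] reduced_append_iff[of "[l]" "g @ [letter_inv l]"]
        by (auto simp: word_inv_def)
      then show ?thesis
        using g eq unfolding core_decomposable_def by metis
    qed
  next
    case (snoc w' c)
    then have zz: "z = letter_inv c # word_inv w' @ g @ w' @ [c]" using z(1) by simp
    show ?thesis
    proof (cases "c = l")
      case True
      then have "letter_conj l z = word_inv w' @ g @ w'"
        unfolding conj by (simp add: zz butlast_append)
      moreover have "reduced_word (word_inv w' @ g @ w')"
        using z(2) reduced_ConsD[of "letter_inv c" "(word_inv w' @ g @ w') @ [c]"]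
        by (simp add: zz reduced_append_iff[of "word_inv w' @ g @ w'" "[c]", simplified])
      ultimately show ?thesis using g unfolding core_decomposable_def by metis
    next
      case False
      then have eq: "letter_conj l z = l # z @ [letter_inv l]"
        unfolding conj by (simp add: zz)
      also have "\<dots> = word_inv (w @ [letter_inv l]) @ g @ w @ [letter_inv l]"
        by (simp add: z(1))
      finally have eq': "letter_conj l z = word_inv (w @ [letter_inv l]) @ g @ w @ [letter_inv l]" .
      have "reduced_word (z @ [letter_inv l])"
        using z(2) False by (subst reduced_append_iff) (auto simp: zz)
      then have "reduced_word (l # z @ [letter_inv l])"
        using False by (simp add: zz)
      then show ?thesis using g eq eq' unfolding core_decomposable_def by metis
    qed
  qed
qed

lemma conjugacy_class_props:
  assumes "\<CC> \<in> conjugacy_classes (free_group :: 'a letter list monoid)"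
  shows "\<CC> \<noteq> {}"
    and "x \<in> \<CC> \<Longrightarrow> reduced_word x"
    and "\<lbrakk>x \<in> \<CC>; y \<in> \<CC>\<rbrakk> \<Longrightarrow> \<exists>g. reduced_word g \<and>
           y = g \<otimes>\<^bsub>free_group\<^esub> x \<otimes>\<^bsub>free_group\<^esub> inv\<^bsub>free_group\<^esub> g"
    and "\<lbrakk>x \<in> \<CC>; reduced_word g\<rbrakk> \<Longrightarrow> g \<otimes>\<^bsub>free_group\<^esub> x \<otimes>\<^bsub>free_group\<^esub> inv\<^bsub>free_group\<^esub> g \<in> \<CC>"
proof -
  let ?F = "free_group :: 'a letter list monoid"
  interpret F: group ?F by (rule group_free_group)
  define cj where "cj g x = g \<otimes>\<^bsub>?F\<^esub> x \<otimes>\<^bsub>?F\<^esub> inv\<^bsub>?F\<^esub> g" for g x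
  define W where "W = carrier ?F"
  have W: "g \<in> W \<longleftrightarrow> reduced_word g" for g by (simp add: W_def)
  have "\<CC> \<in> (\<lambda>x. {cj g x | g. g \<in> W}) ` W"
    using assms unfolding conjugacy_classes_def cj_def W_def .
  then obtain x0 where x0: "x0 \<in> W" and C: "\<CC> = {cj g x0 | g. g \<in> W}"
    by (elim imageE) (rule that)
  have closed: "cj g x \<in> W" if "g \<in> W" "x \<in> W" for g x
    using that unfolding W_def cj_def by (intro F.m_closed F.inv_closed)
  have comp: "cj g (cj h x) = cj (g \<otimes>\<^bsub>?F\<^esub> h) x" if "g \<in> W" "h \<in> W" "x \<in> W" for g h x
    using that unfolding W_def cj_def
    by (simp only: F.inv_mult_group F.m_assoc F.m_closed F.inv_closed)
  have mult: "g \<otimes>\<^bsub>?F\<^esub> h \<in> W" if "g \<in> W" "h \<in> W" for g h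
    using that unfolding W_def by (rule F.m_closed)
  have inv: "inv\<^bsub>?F\<^esub> g \<in> W" if "g \<in> W" for g
    using that unfolding W_def by (rule F.inv_closed)
  have "cj \<one>\<^bsub>?F\<^esub> x0 \<in> \<CC>" unfolding C using F.one_closed W_def by blast
  then show "\<CC> \<noteq> {}" by blast
  show "reduced_word x" if "x \<in> \<CC>" for x
    using that closed x0 unfolding C W by blast
  show "g \<otimes>\<^bsub>?F\<^esub> x \<otimes>\<^bsub>?F\<^esub> inv\<^bsub>?F\<^esub> g \<in> \<CC>" if xC: "x \<in> \<CC>" and rg: "reduced_word g" for x g
  proof -
    have g: "g \<in> W" using rg W by simp
    obtain h where h: "h \<in> W" "x = cj h x0" using xC unfolding C by blast
    have "cj g x = cj (g \<otimes>\<^bsub>?F\<^esub> h) x0" unfolding h(2) by (rule comp[OF g h(1) x0])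
    then show ?thesis unfolding C cj_def[symmetric] using mult[OF g h(1)] by blast
  qed
  show "\<exists>g. reduced_word g \<and> y = g \<otimes>\<^bsub>?F\<^esub> x \<otimes>\<^bsub>?F\<^esub> inv\<^bsub>?F\<^esub> g" if xC: "x \<in> \<CC>" and yC: "y \<in> \<CC>" for x y
  proof -
    obtain h where h: "h \<in> W" "x = cj h x0" using xC unfolding C by blast
    obtain h' where h': "h' \<in> W" "y = cj h' x0" using yC unfolding C by blast
    define g where "g = h' \<otimes>\<^bsub>?F\<^esub> inv\<^bsub>?F\<^esub> h"
    have g: "g \<in> W" unfolding g_def by (intro mult inv h h')
    have "g \<otimes>\<^bsub>?F\<^esub> h = h'"
      using h(1) h'(1) unfolding g_def W_def by (simp only: F.m_assoc F.inv_closed F.l_inv F.r_one)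
    then have "cj g x = y"
      unfolding h(2) h'(2) comp[OF g h(1) x0] by (simp only:)
    then show ?thesis using g unfolding cj_def[symmetric] W by blast
  qed
qed

lemma conjugate_by_word:
  assumes "reduced_word (word_inv w @ g @ w)"
  shows "inv\<^bsub>free_group\<^esub> w \<otimes>\<^bsub>free_group\<^esub> g \<otimes>\<^bsub>free_group\<^esub> inv\<^bsub>free_group\<^esub> (inv\<^bsub>free_group\<^esub> w) = word_inv w @ g @ w"
    and "w \<otimes>\<^bsub>free_group\<^esub> (word_inv w @ g @ w) \<otimes>\<^bsub>free_group\<^esub> inv\<^bsub>free_group\<^esub> w = g"
proof -
  interpret F: group "free_group :: 'a letter list monoid" by (rule group_free_group)
  have r: "reduced_word w" "reduced_word g" "reduced_word (word_inv w @ g)"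
    using assms by (auto simp: reduced_append_iff)
  have c: "w \<in> carrier free_group" "g \<in> carrier free_group" using r by simp_all
  have e: "inv\<^bsub>free_group\<^esub> w \<otimes>\<^bsub>free_group\<^esub> g \<otimes>\<^bsub>free_group\<^esub> w = word_inv w @ g @ w"
    using r assms foldr_reduced_append[of "word_inv w" g] foldr_reduced_append[of "word_inv w @ g" w]
    by (simp add: inv_free_group)
  then show "inv\<^bsub>free_group\<^esub> w \<otimes>\<^bsub>free_group\<^esub> g \<otimes>\<^bsub>free_group\<^esub> inv\<^bsub>free_group\<^esub> (inv\<^bsub>free_group\<^esub> w) = word_inv w @ g @ w"
    using F.inv_inv[OF c(1)] by metis
  have "w \<otimes>\<^bsub>free_group\<^esub> (inv\<^bsub>free_group\<^esub> w \<otimes>\<^bsub>free_group\<^esub> g \<otimes>\<^bsub>free_group\<^esub> w) \<otimes>\<^bsub>free_group\<^esub> inv\<^bsub>free_group\<^esub> w = g"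
    using c by (simp only: F.m_assoc[symmetric] F.r_inv F.m_closed F.inv_closed F.l_one)
      (simp only: F.m_assoc F.r_inv F.m_closed F.inv_closed F.r_one)
  then show "w \<otimes>\<^bsub>free_group\<^esub> (word_inv w @ g @ w) \<otimes>\<^bsub>free_group\<^esub> inv\<^bsub>free_group\<^esub> w = g"
    unfolding e .
qed

text \<open>
  A shortest element is cyclically reduced, since cancelling its first letter against its last one would
  conjugate it to a shorter element. All elements arise from it by conjugation with single letters, which
  preserves the normal form.
\<close>

lemma conjugacy_class_core:
  fixes \<CC> :: "'a letter list set"
  assumes C: "\<CC> \<in> conjugacy_classes free_group" and ne: "\<CC> \<noteq> {[]}"
  shows "of_length \<CC> (min_length \<CC>) \<noteq> {}"
    and "g \<in> of_length \<CC> (min_length \<CC>) \<Longrightarrow> cyclically_reduced g"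
    and "z \<in> \<CC> \<Longrightarrow> core_decomposable (min_length \<CC>) z"
proof -
  define k where "k = min_length \<CC>"
  have le: "k \<le> length x" if "x \<in> \<CC>" for x
    unfolding k_def min_length_def by (rule cINF_lower[OF bdd_below_bot that])
  have "k \<in> length ` \<CC>"
    unfolding k_def min_length_def using conjugacy_class_props(1)[OF C] by (intro Inf_nat_def1) auto
  then show ex: "of_length \<CC> (min_length \<CC>) \<noteq> {}"
    by (auto simp: of_length_def k_def[symmetric])
  show cyc: "cyclically_reduced g" if "g \<in> of_length \<CC> (min_length \<CC>)" for g
  proof -
    have g: "g \<in> \<CC>" "length g = k" using that by (auto simp: of_length_def k_def)
    have r: "reduced_word g" by (rule conjugacy_class_props(2)[OF C g(1)])
    have "g \<noteq> []"
    proof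
      assume "g = []"
      have "y = []" if y: "y \<in> \<CC>" for y
      proof -
        obtain h where h: "reduced_word h" "y = h \<otimes>\<^bsub>free_group\<^esub> g \<otimes>\<^bsub>free_group\<^esub> inv\<^bsub>free_group\<^esub> h"
          using conjugacy_class_props(3)[OF C g(1) y] by blast
        then have "y = h \<otimes>\<^bsub>free_group\<^esub> inv\<^bsub>free_group\<^esub> h"
          using \<open>g = []\<close> by (simp add: foldr_letter_mult_Nil)
        then show ?thesis using group.r_inv[OF group_free_group, of h] h(1) by simp
      qed
      then show False using ne g(1) by blast
    qed
    moreover have "hd g \<noteq> letter_inv (last g)"
    proof
      assume h: "hd g = letter_inv (last g)"
      obtain v c where v: "g = v @ [c]" using \<open>g \<noteq> []\<close> by (cases g rule: rev_cases) auto
      have "v \<noteq> []" using h v by auto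
      then obtain u where u: "v = letter_inv c # u" using h v by (cases v) auto
      have eq: "g = word_inv [c] @ u @ [c]" using v u by (simp add: word_inv_def)
      have "reduced_word [c]" by simp
      \<comment> \<open>conjugation by the last letter cancels both ends of \<open>g\<close>\<close>
      from conjugacy_class_props(4)[OF C g(1) this]
      have "u \<in> \<CC>" using conjugate_by_word(2)[of "[c]" u] r unfolding eq by metis
      from le[OF this] show False using g(2) v u by simp
    qed
    ultimately show ?thesis using r by (simp add: cyclically_reduced_def)
  qed
  obtain g0 where g0: "g0 \<in> of_length \<CC> k" using ex by (auto simp: k_def)
  then have base: "core_decomposable k g0" and g0C: "g0 \<in> \<CC>" and r0: "reduced_word g0"
    using cyc[of g0] core_decomposable_self[of g0] by (auto simp: k_def of_length_def cyclically_reduced_def)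
  have "core_decomposable k (h \<otimes>\<^bsub>free_group\<^esub> g0 \<otimes>\<^bsub>free_group\<^esub> inv\<^bsub>free_group\<^esub> h)" if "reduced_word h" for h
    using that
  proof (induction h)
    case Nil
    have "inv\<^bsub>free_group\<^esub> ([] :: 'a letter list) = []" by (simp add: inv_free_group)
    then show ?case using base r0 by (simp add: foldr_letter_mult_Nil)
  next
    case (Cons l h)
    interpret F: group "free_group :: 'a letter list monoid" by (rule group_free_group)
    have h: "reduced_word h" using Cons.prems by (rule reduced_ConsD)
    have lh: "l # h = [l] \<otimes>\<^bsub>free_group\<^esub> h" using Cons.prems by (simp add: letter_mult_reduced)
    have c: "[l] \<in> carrier free_group" "h \<in> carrier free_group" "g0 \<in> carrier free_group"
      using h r0 by simp_all
    define y where "y = h \<otimes>\<^bsub>free_group\<^esub> g0 \<otimes>\<^bsub>free_group\<^esub> inv\<^bsub>free_group\<^esub> h"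
    have "(l # h) \<otimes>\<^bsub>free_group\<^esub> g0 \<otimes>\<^bsub>free_group\<^esub> inv\<^bsub>free_group\<^esub> (l # h)
        = [l] \<otimes>\<^bsub>free_group\<^esub> (y \<otimes>\<^bsub>free_group\<^esub> inv\<^bsub>free_group\<^esub> [l])"
      unfolding lh y_def using c by (simp only: F.inv_mult_group F.m_assoc F.m_closed F.inv_closed)
    also have "\<dots> = letter_conj l y"
      by (simp add: inv_free_group letter_conj_def word_inv_def)
    finally show ?case
      using core_decomposable_letter_conj[OF Cons.IH[OF h]] by (simp only: y_def)
  qed
  then show "core_decomposable (min_length \<CC>) z" if "z \<in> \<CC>" for z
    using conjugacy_class_props(3)[OF C g0C that] unfolding k_def by blast
qed

definition allowed_first :: "'a letter list \<Rightarrow> 'a letter set" where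
  "allowed_first g = UNIV - {hd g, letter_inv (last g)}"

lemma reduced_conjugate_iff:
  assumes "cyclically_reduced g" "w \<noteq> []"
  shows "reduced_word (word_inv w @ g @ w) \<longleftrightarrow> reduced_word w \<and> hd w \<in> allowed_first g"
  using assms
  by (auto simp: reduced_append_iff cyclically_reduced_def allowed_first_def last_word_inv)

text \<open>
  The lengths of \<open>g\<close> and \<open>w\<close> are prescribed, so the product determines both. The two excluded first
  letters of \<open>w\<close> are those that would cancel against an end of \<open>g\<close>.
\<close>

lemma conjugacy_class_of_length:
  fixes \<CC> :: "'a letter list set"
  assumes C: "\<CC> \<in> conjugacy_classes free_group" and ne: "\<CC> \<noteq> {[]}"
  defines "k \<equiv> min_length \<CC>"
  shows "bij_betw (\<lambda>(g, w). word_inv w @ g @ w)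
    (SIGMA g:of_length \<CC> k. {w \<in> words (Suc n). hd w \<in> allowed_first g}) (of_length \<CC> (k + 2 * Suc n))"
proof (rule bij_betwI')
  note props = conjugacy_class_props[OF C] and core = conjugacy_class_core[OF C ne, folded k_def]
  let ?S = "SIGMA g:of_length \<CC> k. {w \<in> words (Suc n). hd w \<in> allowed_first g}"
  fix p assume p: "p \<in> ?S"
  obtain g w where gw: "p = (g, w)" by force
  have g: "g \<in> \<CC>" "length g = k" "cyclically_reduced g" and w: "length w = Suc n" "reduced_word w" "hd w \<in> allowed_first g"
    using p core(2)[of g] by (auto simp: gw of_length_def words_def)
  have r: "reduced_word (word_inv w @ g @ w)"
    using w by (subst reduced_conjugate_iff[OF g(3)]) auto
  have "inv\<^bsub>free_group\<^esub> w = word_inv w" by (rule inv_free_group[OF w(2)])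
  then have "word_inv w @ g @ w \<in> \<CC>"
    using props(4)[OF g(1), of "inv\<^bsub>free_group\<^esub> w"] conjugate_by_word(1)[OF r] w(2) by simp
  then show "(case p of (g, w) \<Rightarrow> word_inv w @ g @ w) \<in> of_length \<CC> (k + 2 * Suc n)"
    using g w by (simp add: gw of_length_def)
  fix p' assume p': "p' \<in> ?S"
  then show "((case p of (g, w) \<Rightarrow> word_inv w @ g @ w) = (case p' of (g, w) \<Rightarrow> word_inv w @ g @ w)) = (p = p')"
    using p by (auto simp: of_length_def words_def)
next
  note props = conjugacy_class_props[OF C] and core = conjugacy_class_core[OF C ne, folded k_def]
  fix z assume "z \<in> of_length \<CC> (k + 2 * Suc n)"
  then have z: "z \<in> \<CC>" "length z = k + 2 * Suc n" by (auto simp: of_length_def)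
  obtain g w where gw: "z = word_inv w @ g @ w" "reduced_word z" "cyclically_reduced g" "length g = k"
    using core(3)[OF z(1)] by (auto simp: core_decomposable_def)
  have w: "length w = Suc n" using z(2) gw(1,4) by simp
  then have w': "reduced_word w \<and> hd w \<in> allowed_first g"
    using reduced_conjugate_iff[OF gw(3)] gw(1,2) by (metis length_0_conv nat.distinct(1))
  have "g \<in> \<CC>"
    using props(4)[OF z(1), of w] conjugate_by_word(2)[of w g] gw(1,2) w' by simp
  then have "(g, w) \<in> (SIGMA g:of_length \<CC> k. {w \<in> words (Suc n). hd w \<in> allowed_first g})"
    using gw w w' by (simp add: of_length_def words_def)
  then show "\<exists>p\<in>SIGMA g:of_length \<CC> k. {w \<in> words (Suc n). hd w \<in> allowed_first g}.
      z = (case p of (g, w) \<Rightarrow> word_inv w @ g @ w)"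
    using gw(1) by (intro bexI[of _ "(g, w)"]) auto
qed

section \<open>From characteristic functions to distribution functions\<close>

lemma normal_cdf_standardize:
  assumes "0 < v"
  shows "normal_cdf 0 v a = cdf std_normal_distribution (a / sqrt v)"
proof -
  have sv: "0 < sqrt v" using assms by simp
  let ?M = "density lborel (\<lambda>x. ennreal (normal_density 0 (sqrt v) x))"
  interpret prob_space ?M by (rule prob_space_normal_density[OF sv])
  have "distributed ?M lborel (\<lambda>x. x) (\<lambda>x. ennreal (normal_density 0 (sqrt v) x))"
    by (auto simp: distributed_def distr_id2 sets_density cong: distr_cong)
  then have "distributed ?M lborel (\<lambda>x. (x - 0) / sqrt v) (\<lambda>x. ennreal (std_normal_density x))"
    using normal_standard_normal_convert[OF sv, of "\<lambda>x. x" 0] by simp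
  then have d: "distr ?M lborel (\<lambda>x. x / sqrt v) = std_normal_distribution"
    by (simp add: distributed_def)
  have "cdf std_normal_distribution (a / sqrt v) = measure (distr ?M lborel (\<lambda>x. x / sqrt v)) {..a / sqrt v}"
    by (simp add: cdf_def d)
  also have "\<dots> = measure ?M ((\<lambda>x. x / sqrt v) -` {..a / sqrt v} \<inter> space ?M)"
    by (rule measure_distr) auto
  also have "(\<lambda>x. x / sqrt v) -` {..a / sqrt v} \<inter> space ?M = {..a}"
    using sv by (auto simp: divide_le_cancel)
  finally show ?thesis by (simp add: normal_cdf_def cdf_def)
qed

lemma isCont_cdf_std_normal: "isCont (cdf std_normal_distribution) x"
proof -
  interpret real_distribution std_normal_distribution by (rule real_dist_normal_dist)
  have "emeasure std_normal_distribution {x}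
      = (\<integral>\<^sup>+y. ennreal (std_normal_density y) * indicator {x} y \<partial>lborel)"
    by (rule emeasure_density) auto
  also have "\<dots> = 0"
  proof (subst nn_integral_0_iff_AE)
    show "AE y in lborel. ennreal (std_normal_density y) * indicator {x} y = 0"
      by (rule eventually_mono[OF AE_lborel_singleton[of x]]) (simp add: indicator_def)
  qed simp
  finally have "emeasure std_normal_distribution {x} = 0" .
  then show ?thesis by (simp add: isCont_cdf measure_def)
qed

text \<open>
  Levy's continuity theorem for uniform distributions on finite sets, after rescaling to the standard
  normal law; the limiting distribution function is continuous, so convergence holds at every point.
\<close>

lemma uniform_average_clt:
  fixes X :: "nat \<Rightarrow> 'b \<Rightarrow> real" and \<Omega> :: "nat \<Rightarrow> 'b set"
  assumes v: "0 < v" and fin: "\<And>n. finite (\<Omega> n)" "\<And>n. \<Omega> n \<noteq> {}"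
    and lim: "\<And>s. (\<lambda>n. (\<Sum>x\<in>\<Omega> n. iexp (s * X n x)) / of_nat (card (\<Omega> n)))
                \<longlonglongrightarrow> complex_of_real (exp (- v * s\<^sup>2 / 2))"
  shows "(\<lambda>n. real (card {x \<in> \<Omega> n. X n x \<le> a}) / real (card (\<Omega> n))) \<longlonglongrightarrow> normal_cdf 0 v a"
proof -
  define P where "P n = measure_pmf (pmf_of_set (\<Omega> n))" for n
  define M where "M n = distr (P n) borel (\<lambda>x. X n x / sqrt v)" for n
  have sv: "0 < sqrt v" using v by simp
  have M: "real_distribution (M n)" for n
    unfolding M_def by (rule prob_space.real_distribution_distr) (auto simp: P_def measure_pmf.prob_space_axioms)
  have "char (M n) t = (\<Sum>x\<in>\<Omega> n. iexp (t / sqrt v * X n x)) / of_nat (card (\<Omega> n))" for n t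
  proof -
    have "char (M n) t = (CLINT x|P n. iexp (t * (X n x / sqrt v)))"
      unfolding char_def M_def by (subst integral_distr) (auto simp: P_def)
    also have "\<dots> = (\<Sum>x\<in>\<Omega> n. pmf (pmf_of_set (\<Omega> n)) x *\<^sub>R iexp (t * (X n x / sqrt v)))"
      unfolding P_def using fin[of n] by (intro integral_measure_pmf) auto
    also have "\<dots> = (\<Sum>x\<in>\<Omega> n. iexp (t / sqrt v * X n x)) / of_nat (card (\<Omega> n))"
      using fin[of n] by (simp add: sum_divide_distrib scaleR_conv_of_real)
    finally show ?thesis .
  qed
  moreover have "- v * (t / sqrt v)\<^sup>2 / 2 = - t\<^sup>2 / 2" for t
    using v by (simp add: power_divide)
  ultimately have "(\<lambda>n. char (M n) t) \<longlonglongrightarrow> char std_normal_distribution t" for t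
    using lim[of "t / sqrt v"] by (simp add: char_std_normal_distribution)
  then have "weak_conv_m M std_normal_distribution"
    by (intro levy_continuity M real_dist_normal_dist)
  then have "(\<lambda>n. cdf (M n) (a / sqrt v)) \<longlonglongrightarrow> cdf std_normal_distribution (a / sqrt v)"
    using isCont_cdf_std_normal unfolding weak_conv_m_def weak_conv_def by blast
  moreover have "cdf (M n) (a / sqrt v) = real (card {x \<in> \<Omega> n. X n x \<le> a}) / real (card (\<Omega> n))" for n
  proof -
    have "cdf (M n) (a / sqrt v) = measure (P n) ((\<lambda>x. X n x / sqrt v) -` {..a / sqrt v} \<inter> space (P n))"
      unfolding cdf_def M_def by (rule measure_distr) (auto simp: P_def)
    also have "(\<lambda>x. X n x / sqrt v) -` {..a / sqrt v} \<inter> space (P n) = {x. X n x \<le> a}"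
      using sv by (auto simp: divide_le_cancel P_def)
    finally show ?thesis
      using fin[of n] by (simp add: P_def measure_pmf_of_set Int_def)
  qed
  ultimately show ?thesis by (simp add: normal_cdf_standardize[OF v])
qed

section \<open>Comparison of finite and infinite words\<close>

lemma hoelder_with_of_hoelder_on:
  assumes theta: "0 < \<theta>" "\<theta> < 1" and h: "hoelder_on S (d_theta \<theta>) f"
  shows "\<exists>\<beta> K. 1/2 \<le> \<beta> \<and> \<beta> < 1 \<and> hoelder_with K \<beta> S f"
proof -
  obtain \<alpha> C where \<alpha>: "0 < \<alpha>" and C: "\<And>x y. \<lbrakk>x \<in> S; y \<in> S\<rbrakk> \<Longrightarrow> \<bar>f x - f y\<bar> \<le> C * d_theta \<theta> x y powr \<alpha>"
    using h unfolding hoelder_on_def by blast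
  define \<beta> where "\<beta> = max (\<theta> powr \<alpha>) (1/2)"
  have t1: "\<theta> powr \<alpha> < 1" using theta \<alpha> powr_less_mono2[of \<alpha> \<theta> 1] by simp
  have "hoelder_with \<bar>C\<bar> \<beta> S f"
  proof (rule hoelder_withI)
    fix x y N assume xy: "x \<in> S" "y \<in> S" and eq: "\<And>i. i < N \<Longrightarrow> x i = y i"
    have "d_theta \<theta> x y powr \<alpha> \<le> \<beta> ^ N"
    proof (cases "x = y")
      case False
      define m where "m = (LEAST n. x n \<noteq> y n)"
      have "x m \<noteq> y m"
        unfolding m_def by (rule LeastI_ex) (use False in blast)
      then have "N \<le> m" using eq[of m] by (meson not_le)
      have "d_theta \<theta> x y powr \<alpha> = (\<theta> ^ m) powr \<alpha>" using False by (simp add: d_theta_def m_def)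
      also have "\<dots> = (\<theta> powr \<alpha>) ^ m"
        using theta by (simp add: powr_realpow[symmetric] powr_powr mult.commute)
      also have "\<dots> \<le> (\<theta> powr \<alpha>) ^ N"
        using \<open>N \<le> m\<close> t1 by (intro power_decreasing) auto
      also have "\<dots> \<le> \<beta> ^ N" by (intro power_mono) (auto simp: \<beta>_def)
      finally show ?thesis .
    qed (simp add: d_theta_def \<beta>_def)
    then have "C * d_theta \<theta> x y powr \<alpha> \<le> \<bar>C\<bar> * \<beta> ^ N" by (intro mult_mono) auto
    then show "\<bar>f x - f y\<bar> \<le> \<bar>C\<bar> * \<beta> ^ N" using C[OF xy] by linarith
  qed
  moreover have "1/2 \<le> \<beta>" "\<beta> < 1" using t1 by (auto simp: \<beta>_def)
  ultimately show ?thesis by blast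
qed

text \<open>
  Bounded distortion: the \<open>j\<close>-th shifts agree in \<open>n - j\<close> symbols, so the terms of the Birkhoff sums differ
  by a geometric sequence, whose sum is bounded independently of \<open>n\<close>.
\<close>

lemma birkhoff_sum_close:
  assumes \<beta>: "0 < \<beta>" "\<beta> < 1" and K: "0 \<le> K" and h: "hoelder_with K \<beta> S f"
    and shift: "\<And>x. x \<in> S \<Longrightarrow> seq_shift x \<in> S"
    and xy: "x \<in> S" "y \<in> S" "\<And>i. i < n \<Longrightarrow> x i = y i"
  shows "\<bar>birkhoff_sum f n x - birkhoff_sum f n y\<bar> \<le> K / (1 - \<beta>)"
proof -
  have "\<bar>birkhoff_sum f n x - birkhoff_sum f n y\<bar> \<le> K * (1 - \<beta> ^ n) / (1 - \<beta>)"
    using xy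
  proof (induction n arbitrary: x y)
    case (Suc n)
    have "\<bar>birkhoff_sum f n (seq_shift x) - birkhoff_sum f n (seq_shift y)\<bar> \<le> K * (1 - \<beta> ^ n) / (1 - \<beta>)"
      using Suc.prems by (intro Suc.IH shift) (auto simp: seq_shift_def)
    moreover have "\<bar>f x - f y\<bar> \<le> K * \<beta> ^ Suc n"
      by (rule hoelder_withD[OF h Suc.prems])
    moreover have "K * \<beta> ^ Suc n \<le> K * \<beta> ^ n"
      using \<beta> K by (intro mult_left_mono power_decreasing) auto
    moreover have "K * (1 - \<beta> ^ n) / (1 - \<beta>) + K * \<beta> ^ n = K * (1 - \<beta> ^ Suc n) / (1 - \<beta>)"
      using \<beta> by (simp add: field_simps)
    ultimately show ?case unfolding birkhoff_sum_Suc by linarith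
  qed simp
  also have "\<dots> \<le> K / (1 - \<beta>)"
    using \<beta> K by (intro divide_right_mono) (auto simp: algebra_simps)
  finally show ?thesis .
qed

lemma seq_shift_word_seq: "seq_shift (word_seq w) = word_seq (tl w)"
  by (auto simp: fun_eq_iff seq_shift_def word_seq_def nth_tl)

lemma funpow_shift_word_seq: "(seq_shift ^^ n) (word_seq w) = word_seq (drop n w)"
  by (induction n arbitrary: w) (simp_all add: funpow_swap1 seq_shift_word_seq drop_Suc tl_drop)

lemma word_seq_all_words: "reduced_word w \<Longrightarrow> word_seq w \<in> all_words"
  by (simp add: all_words_def)

lemma inf_words_all_words: "x \<in> inf_words \<Longrightarrow> x \<in> all_words"
  by (simp add: all_words_def)

lemma seq_shift_all_words:
  assumes "x \<in> all_words"
  shows "seq_shift x \<in> all_words"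
proof -
  consider "x \<in> inf_words" | w where "reduced_word w" "x = word_seq w"
    using assms by (auto simp: all_words_def)
  then show ?thesis
  proof cases
    case 2
    then have "reduced_word (tl w)" by (cases w) (auto dest: reduced_ConsD)
    then show ?thesis using 2 by (simp add: seq_shift_word_seq word_seq_all_words)
  qed (auto intro: inf_words_all_words)
qed

lemma birkhoff_sum_all_words_bound:
  assumes "\<And>y. y \<in> all_words \<Longrightarrow> \<bar>f y - c\<bar> \<le> M" "x \<in> all_words"
  shows "\<bar>birkhoff_sum f n x - real n * c\<bar> \<le> real n * M"
  using assms(2)
proof (induction n arbitrary: x)
  case (Suc n)
  show ?case
    using assms(1)[OF Suc.prems] Suc.IH[OF seq_shift_all_words[OF Suc.prems]]
    by (simp add: birkhoff_sum_Suc algebra_simps)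
qed simp

lemma extend_word_first: "w \<noteq> [] \<Longrightarrow> extend_word w 0 = Some (hd w)"
  using extend_word_nth[of 0 w] by (simp add: hd_conv_nth)

context max_entropy_shift
begin

lemma sum_words_first_letter:
  fixes h :: "'a letter_seq \<Rightarrow> complex"
  shows "(\<Sum>w | w \<in> words (Suc n) \<and> hd w \<in> B. h (extend_word w))
    = of_real (q ^ n) * (\<Sum>c\<in>UNIV. (transfer ^^ n) (\<lambda>y. h y * of_real (starts_in B y)) (\<lambda>_. Some c))"
proof -
  have "(\<Sum>w | w \<in> words (Suc n) \<and> hd w \<in> B. h (extend_word w))
      = (\<Sum>w\<in>words (Suc n). if hd w \<in> B then h (extend_word w) else 0)"
    by (simp add: sum.inter_filter[symmetric])
  also have "\<dots> = (\<Sum>w\<in>words (Suc n). h (extend_word w) * of_real (starts_in B (extend_word w)))"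
  proof (rule sum.cong[OF refl])
    fix w :: "'a letter list" assume "w \<in> words (Suc n)"
    then have "w \<noteq> []" by (auto simp: words_def)
    then show "(if hd w \<in> B then h (extend_word w) else 0) = h (extend_word w) * of_real (starts_in B (extend_word w))"
      by (auto simp: starts_in_def extend_word_first)
  qed
  finally show ?thesis
    by (simp add: sum_words_extend[of "\<lambda>y. h y * of_real (starts_in B y)"] q_def scaleR_conv_of_real)
qed

lemma allowed_first_nonempty: "allowed_first (g :: 'a letter list) \<noteq> {}"
proof
  assume "allowed_first g = {}"
  then have "card (UNIV :: 'a letter set) \<le> card {hd g, letter_inv (last g)}"
    by (intro card_mono) (auto simp: allowed_first_def)
  also have "\<dots> \<le> 2" by (simp add: card_insert_if)
  finally show False using rank by simp
qed

section \<open>The central limit theorem on a conjugacy class\<close>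

text \<open>
  The uniform average over the class is a quotient of two sums over pairs \<open>(g, w)\<close>. Both are values of
  the same function \<open>N n\<close> of the frequency, the denominator being the value at frequency zero, and the
  factors \<open>q ^ n\<close> as well as the masses of the allowed first letters cancel in the quotient. An
  error \<open>D\<close> in the values of \<open>F\<close> tends to zero after division by \<open>sqrt (k + 2 * m)\<close>.
\<close>

lemma conjugacy_class_clt:
  fixes \<CC> :: "'a letter list set" and F :: "'a letter list \<Rightarrow> real"
  assumes C: "\<CC> \<in> conjugacy_classes free_group" and ne: "\<CC> \<noteq> {[]}"
    and xi: "hoelder \<beta> \<xi>" and mart: "\<And>x. x \<in> inf_words \<Longrightarrow> transfer \<xi> x = 0"
    and pos: "0 < (\<integral>x. (\<xi> x)\<^sup>2 \<partial>\<mu>)"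
  defines "k \<equiv> min_length \<CC>"
  assumes F: "\<And>g w n. \<lbrakk>g \<in> of_length \<CC> k; w \<in> words (Suc n); reduced_word (word_inv w @ g @ w)\<rbrakk>
      \<Longrightarrow> \<bar>F (word_inv w @ g @ w) - real (k + 2 * Suc n) * c - 2 * birkhoff_sum \<xi> n (extend_word w)\<bar> \<le> D"
  shows "(\<lambda>m. real (card {x \<in> of_length \<CC> (k + 2 * m).
                    (F x - real (k + 2 * m) * c) / sqrt (real (k + 2 * m)) \<le> a})
                / real (card (of_length \<CC> (k + 2 * m))))
           \<longlonglongrightarrow> normal_cdf 0 (2 * (\<integral>x. (\<xi> x)\<^sup>2 \<partial>\<mu>)) a"
proof -
  define \<sigma>2 where "\<sigma>2 = (\<integral>x. (\<xi> x)\<^sup>2 \<partial>\<mu>)"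
  define G where "G = of_length \<CC> k"
  define W where "W n g = {w. w \<in> words (Suc n) \<and> hd w \<in> allowed_first g}" for n and g :: "'a letter list"
  define \<Omega> where "\<Omega> n = of_length \<CC> (k + 2 * Suc n)" for n
  define r where "r n = sqrt (real (k + 2 * Suc n))" for n
  define X where "X n x = (F x - real (k + 2 * Suc n) * c) / r n" for n x
  define e where "e p = (case p of (g, w) \<Rightarrow> word_inv w @ g @ w)" for p :: "'a letter list \<times> 'a letter list"
  note core = conjugacy_class_core[OF C ne, folded k_def, folded G_def]
  have r: "0 < r n" for n by (simp add: r_def)
  have bij: "bij_betw e (Sigma G (W n)) (\<Omega> n)" for n
    using conjugacy_class_of_length[OF C ne, of n]
    by (simp add: e_def[abs_def] G_def W_def[abs_def] \<Omega>_def k_def)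
  have finG: "finite G"
    by (rule finite_subset[OF _ finite_words[of k]])
      (use conjugacy_class_props(2)[OF C] in \<open>auto simp: G_def of_length_def words_def\<close>)
  have finW: "finite (W n g)" for n g by (simp add: W_def)
  have neG: "G \<noteq> {}" using core(1) by simp
  have sumS: "(\<Sum>x\<in>\<Omega> n. \<phi> x) = (\<Sum>g\<in>G. \<Sum>w\<in>W n g. \<phi> (e (g, w)))" for \<phi> :: "_ \<Rightarrow> complex" and n
  proof -
    have "(\<Sum>x\<in>\<Omega> n. \<phi> x) = (\<Sum>p\<in>Sigma G (W n). \<phi> (e p))"
      by (rule sum.reindex_bij_betw[OF bij, symmetric])
    also have "\<dots> = (\<Sum>g\<in>G. \<Sum>w\<in>W n g. \<phi> (e (g, w)))"
      using finG finW by (subst sum.Sigma) auto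
    finally show ?thesis .
  qed
  define N where "N n t = (\<Sum>g\<in>G. \<Sum>w\<in>W n g. iexp (t * birkhoff_sum \<xi> n (extend_word w)))" for n t
  define b where "b g = (\<integral>x. starts_in (allowed_first g) x \<partial>\<mu>)" for g
  define b' where "b' = (\<Sum>g\<in>G. \<Sum>c\<in>(UNIV :: 'a letter set). b g)"
  have b_pos: "0 < (\<Sum>c\<in>(UNIV :: 'a letter set). b g)" for g
    unfolding b_def by (intro sum_pos integral_starts_in allowed_first_nonempty) auto
  have b': "0 < b'" unfolding b'_def by (rule sum_pos[OF finG neG b_pos])
  have Nlim: "(\<lambda>n. N n (t n) / of_real (q ^ n)) \<longlonglongrightarrow> of_real (b' * exp (- \<sigma>2 * \<tau> / 2))"
    if t: "t \<longlonglongrightarrow> 0" "(\<lambda>n. real n * (t n)\<^sup>2) \<longlonglongrightarrow> \<tau>" for t \<tau>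
  proof -
    have "N n (t n) / of_real (q ^ n) = (\<Sum>g\<in>G. \<Sum>c\<in>UNIV.
       (transfer ^^ n) (\<lambda>y. iexp (t n * birkhoff_sum \<xi> n y) * of_real (starts_in (allowed_first g) y)) (\<lambda>_. Some c))" for n
      using q_ge unfolding N_def W_def
      by (simp only: sum_words_first_letter[where h = "\<lambda>y. iexp (t n * birkhoff_sum \<xi> n y)"]
          sum_distrib_left[symmetric]) simp
    moreover have "(\<lambda>n. \<Sum>g\<in>G. \<Sum>c\<in>UNIV.
       (transfer ^^ n) (\<lambda>y. iexp (t n * birkhoff_sum \<xi> n y) * of_real (starts_in (allowed_first g) y)) (\<lambda>_. Some c))
       \<longlonglongrightarrow> (\<Sum>g\<in>G. \<Sum>c\<in>(UNIV :: 'a letter set). of_real (b g) * of_real (exp (- \<sigma>2 * \<tau> / 2)))"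
      unfolding b_def \<sigma>2_def
      by (intro tendsto_sum transfer_clt[OF xi mart] t allowed_first_nonempty constant_word_inf_words)
    moreover have "(\<Sum>g\<in>G. \<Sum>c\<in>(UNIV :: 'a letter set). complex_of_real (b g) * of_real (exp (- \<sigma>2 * \<tau> / 2)))
        = of_real (b' * exp (- \<sigma>2 * \<tau> / 2))"
      by (simp only: b'_def of_real_mult of_real_sum sum_distrib_right)
    ultimately show ?thesis by simp
  qed
  have card: "of_nat (card (\<Omega> n)) = N n 0" for n
    using sumS[of "\<lambda>_. 1" n] by (simp add: N_def)
  have ne\<Omega>: "\<Omega> n \<noteq> {}" for n
  proof -
    obtain g where g: "g \<in> G" using neG by blast
    obtain l where l: "l \<in> allowed_first g" using allowed_first_nonempty by blast
    \<comment> \<open>powers of a letter are reduced\<close>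
    have "replicate (Suc n) l \<in> W n g"
      using l by (auto simp: W_def words_def reduced_word_def successively_conv_nth simp del: replicate_Suc)
    then have "(g, replicate (Suc n) l) \<in> Sigma G (W n)" using g by blast
    then show ?thesis using bij_betw_imp_surj_on[OF bij, of n] by blast
  qed
  have fin\<Omega>: "finite (\<Omega> n)" for n
    using bij_betw_finite[OF bij[of n]] finG finW by auto
  have key: "(\<lambda>n. (\<Sum>x\<in>\<Omega> n. iexp (s * X n x)) / of_nat (card (\<Omega> n)))
        \<longlonglongrightarrow> complex_of_real (exp (- (2 * \<sigma>2) * s\<^sup>2 / 2))" for s
  proof -
    \<comment> \<open>the factor \<open>2\<close> is the one in \<open>F(w\<inverse> g w) = 2 F(w) + O(1)\<close>; the variance is doubled, and
      not quadrupled, because only about half of the \<open>k + 2 * m\<close> letters are free\<close>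
    define t where "t n = 2 * s / r n" for n
    have t0: "t \<longlonglongrightarrow> 0" unfolding t_def r_def by real_asymp
    have t2: "(\<lambda>n. real n * (t n)\<^sup>2) \<longlonglongrightarrow> 2 * s\<^sup>2"
    proof -
      have "real n * (t n)\<^sup>2 = 4 * s\<^sup>2 * (real n / real (k + 2 * Suc n))" for n
        by (simp add: t_def r_def power_divide power_mult_distrib)
      moreover have "(\<lambda>n. real n / real (k + 2 * Suc n)) \<longlonglongrightarrow> 1 / 2" by real_asymp
      then have "(\<lambda>n. 4 * s\<^sup>2 * (real n / real (k + 2 * Suc n))) \<longlonglongrightarrow> 4 * s\<^sup>2 * (1 / 2)"
        by (rule tendsto_mult_left)
      ultimately show ?thesis by simp
    qed
    have 1: "(\<lambda>n. N n (t n) / of_real (q ^ n)) \<longlonglongrightarrow> of_real (b' * exp (- \<sigma>2 * (2 * s\<^sup>2) / 2))"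
      by (rule Nlim[OF t0 t2])
    have 2: "(\<lambda>n. N n 0 / of_real (q ^ n)) \<longlonglongrightarrow> of_real (b' * exp (- \<sigma>2 * 0 / 2))"
      by (rule Nlim) auto
    have "(\<lambda>n. (N n (t n) / of_real (q ^ n)) / (N n 0 / of_real (q ^ n)))
        \<longlonglongrightarrow> of_real (b' * exp (- \<sigma>2 * (2 * s\<^sup>2) / 2)) / of_real (b' * exp (- \<sigma>2 * 0 / 2))"
      by (rule tendsto_divide[OF 1 2]) (use b' in simp)
    then have 3: "(\<lambda>n. N n (t n) / N n 0) \<longlonglongrightarrow> of_real (exp (- (2 * \<sigma>2) * s\<^sup>2 / 2))"
      using b' q_ge by (simp add: mult_ac)
    have le: "cmod ((\<Sum>x\<in>\<Omega> n. iexp (s * X n x)) / of_nat (card (\<Omega> n)) - N n (t n) / N n 0) \<le> \<bar>s\<bar> * D / r n" for n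
    proof -
      have cn: "real (card (\<Omega> n)) > 0" using fin\<Omega> ne\<Omega> by (simp add: card_gt_0_iff)
      have "cmod (iexp (s * X n (e (g, w))) - iexp (t n * birkhoff_sum \<xi> n (extend_word w))) \<le> \<bar>s\<bar> * D / r n"
        if gw: "g \<in> G" "w \<in> W n g" for g w
      proof -
        have w: "w \<in> words (Suc n)" "hd w \<in> allowed_first g" "w \<noteq> []" "reduced_word w"
          using gw by (auto simp: W_def words_def)
        have red: "reduced_word (word_inv w @ g @ w)"
          using reduced_conjugate_iff[OF core(2)[OF gw(1)] w(3)] w by simp
        have "cmod (iexp (s * X n (e (g, w))) - iexp (t n * birkhoff_sum \<xi> n (extend_word w)))
            \<le> \<bar>s * X n (e (g, w)) - t n * birkhoff_sum \<xi> n (extend_word w)\<bar>"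
          by (rule iexp_lipschitz)
        also have "s * X n (e (g, w)) - t n * birkhoff_sum \<xi> n (extend_word w)
            = s / r n * (F (word_inv w @ g @ w) - real (k + 2 * Suc n) * c - 2 * birkhoff_sum \<xi> n (extend_word w))"
          by (simp add: X_def t_def e_def diff_divide_distrib right_diff_distrib)
        also have "\<bar>\<dots>\<bar> \<le> \<bar>s / r n\<bar> * D"
          unfolding abs_mult using F[OF gw(1)[unfolded G_def] w(1) red] by (intro mult_left_mono) auto
        also have "\<dots> = \<bar>s\<bar> * D / r n" using r[of n] by (simp add: abs_divide)
        finally show ?thesis .
      qed
      then have "cmod (\<Sum>p\<in>Sigma G (W n). (case p of (g, w) \<Rightarrow>
          iexp (s * X n (e (g, w))) - iexp (t n * birkhoff_sum \<xi> n (extend_word w))))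
          \<le> real (card (Sigma G (W n))) * (\<bar>s\<bar> * D / r n)"
        by (intro order.trans[OF norm_sum] sum_bounded_above) auto
      also have "(\<Sum>p\<in>Sigma G (W n). (case p of (g, w) \<Rightarrow>
          iexp (s * X n (e (g, w))) - iexp (t n * birkhoff_sum \<xi> n (extend_word w))))
          = (\<Sum>x\<in>\<Omega> n. iexp (s * X n x)) - N n (t n)"
        unfolding sumS N_def sum_subtractf[symmetric] using finG finW by (subst sum.Sigma) auto
      also have "card (Sigma G (W n)) = card (\<Omega> n)" by (rule bij_betw_same_card[OF bij])
      finally have "cmod ((\<Sum>x\<in>\<Omega> n. iexp (s * X n x)) - N n (t n)) / real (card (\<Omega> n)) \<le> \<bar>s\<bar> * D / r n"
        using cn by (simp add: pos_divide_le_eq mult.commute)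
      then show ?thesis
        unfolding card[symmetric] diff_divide_distrib[symmetric] by (simp add: norm_divide)
    qed
    have "(\<lambda>n. \<bar>s\<bar> * D / r n) \<longlonglongrightarrow> 0" unfolding r_def by real_asymp
    then have "(\<lambda>n. (\<Sum>x\<in>\<Omega> n. iexp (s * X n x)) / of_nat (card (\<Omega> n)) - N n (t n) / N n 0) \<longlonglongrightarrow> 0"
      by (rule Lim_null_comparison[OF always_eventually[OF allI[OF le]]])
    from tendsto_add[OF this 3] show ?thesis by simp
  qed
  have "(\<lambda>n. real (card {x \<in> \<Omega> n. X n x \<le> a}) / real (card (\<Omega> n))) \<longlonglongrightarrow> normal_cdf 0 (2 * \<sigma>2) a"
    by (rule uniform_average_clt[OF _ fin\<Omega> ne\<Omega> key]) (use pos in \<open>simp add: \<sigma>2_def\<close>)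
  then show ?thesis
    unfolding \<Omega>_def X_def r_def \<sigma>2_def by (rule LIMSEQ_imp_Suc)
qed

end

text \<open>
  The bound on \<open>F\<close> required by \<open>conjugacy_class_clt\<close> comes from bounded distortion: the first \<open>|w|\<close> terms
  of the Birkhoff sum over \<open>w\<inverse> g w\<close> give \<open>F(w\<inverse>) = F(w)\<close> up to a bounded error, the next
  \<open>k\<close> terms are bounded, and the remaining ones give \<open>F(w)\<close> again. The unboundedness hypothesis excludes variance zero.
\<close>

theorem theorem2p4:
  fixes \<CC> :: "'a::finite letter list set"
    and F :: "'a letter list \<Rightarrow> real"
    and f :: "'a letter_seq \<Rightarrow> real"
    and \<theta> :: real
    and \<mu>\<^sub>0 :: "'a letter_seq measure"
  defines "\<Gamma> \<equiv> (free_group :: 'a letter list monoid)"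
    and "k \<equiv> min_length \<CC>"
    and "Fbar \<equiv> (\<integral>x. f x \<partial>\<mu>\<^sub>0)"
    and "\<sigma>2 \<equiv> asymptotic_variance \<mu>\<^sub>0 f"
  assumes rank: "CARD('a) \<ge> 2"
    and theta: "0 < \<theta>" "\<theta> < 1"
    and mu0: "max_entropy_measure \<theta> \<mu>\<^sub>0"
    and conj_class: "\<CC> \<in> conjugacy_classes \<Gamma>" "\<CC> \<noteq> {\<one>\<^bsub>\<Gamma>\<^esub>}"
    and A1: "hoelder_on all_words (d_theta \<theta>) f"
      "\<And>n x. x \<in> of_length (carrier \<Gamma>) n \<Longrightarrow> F x = birkhoff_sum f n (word_seq x)"
    and A2: "\<And>x. x \<in> carrier \<Gamma> \<Longrightarrow> F x = F (inv\<^bsub>\<Gamma>\<^esub> x)"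
    and A3: "\<not> bounded ((\<lambda>x. F x - Fbar * real (length x)) ` carrier \<Gamma>)"
  shows "convergent (variance_seq \<mu>\<^sub>0 f) \<and> 0 < 2 * \<sigma>2 \<and>
    (\<forall>a. (\<lambda>m. real (card {x \<in> of_length \<CC> (k + 2 * m).
                    (F x - real (k + 2 * m) * Fbar) / sqrt (real (k + 2 * m)) \<le> a})
                / real (card (of_length \<CC> (k + 2 * m))))
           \<longlonglongrightarrow> normal_cdf 0 (2 * \<sigma>2) a)"
proof -
  obtain \<beta> K where \<beta>: "1/2 \<le> \<beta>" "\<beta> < 1" and K: "hoelder_with K \<beta> all_words f"
    using hoelder_with_of_hoelder_on[OF theta A1(1)] by blast
  have KI: "hoelder_with K \<beta> inf_words f"
    using K unfolding hoelder_with_def by (auto intro: inf_words_all_words)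
  interpret max_entropy_shift \<theta> \<mu>\<^sub>0 \<beta> "branching TYPE('a)"
    by unfold_locales (use rank mu0 \<beta> in auto)
  have f: "hoelder \<beta> f" using KI by (auto simp: hoelder_def)
  have K0: "0 \<le> K" by (rule hoelder_with_nonneg[OF KI])
  have "(\<integral>x. f x - Fbar \<partial>\<mu>\<^sub>0) = 0"
    using hoelder_integrable[OF f] by (simp add: prob_space Fbar_def)
  moreover have "hoelder \<beta> (\<lambda>x. f x - Fbar)" using f by (intro hoelder_diff) auto
  ultimately obtain \<xi> u where xi: "hoelder \<beta> \<xi>" and u: "hoelder \<beta> u"
    and mart: "\<And>x. x \<in> inf_words \<Longrightarrow> transfer \<xi> x = 0"
    and dec: "\<And>x. x \<in> inf_words \<Longrightarrow> f x - Fbar = \<xi> x + u (seq_shift x) - u x"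
    using martingale_decomposition[of "\<lambda>x. f x - Fbar"] by blast
  obtain U where U: "\<And>x. x \<in> inf_words \<Longrightarrow> \<bar>u x\<bar> \<le> U" using hoelder_bounded[OF u] by blast
  obtain A where A: "\<And>x. x \<in> inf_words \<Longrightarrow> \<bar>\<xi> x\<bar> \<le> A" using hoelder_bounded[OF xi] by blast
  define s where "s = (\<integral>x. (\<xi> x)\<^sup>2 \<partial>\<mu>\<^sub>0)"
  define D0 where "D0 = K / (1 - \<beta>)"
  have close: "\<bar>birkhoff_sum f n x - birkhoff_sum f n y\<bar> \<le> D0"
    if "x \<in> all_words" "y \<in> all_words" "\<And>i. i < n \<Longrightarrow> x i = y i" for x y n
    unfolding D0_def by (rule birkhoff_sum_close[OF beta_pos(1) beta_less K0 K seq_shift_all_words that])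
  have Fw: "F w = birkhoff_sum f (length w) (word_seq w)" if "reduced_word w" for w
    by (rule A1(2)) (use that in \<open>simp add: of_length_def \<Gamma>_def\<close>)
  have ext: "\<bar>(F w - real (length w) * Fbar) - birkhoff_sum \<xi> (length w) (extend_word w)\<bar> \<le> D0 + 2 * U"
    if w: "reduced_word w" "w \<noteq> []" for w
  proof -
    have e: "extend_word w \<in> inf_words" by (rule extend_word_inf_words[OF w])
    have "\<bar>birkhoff_sum f (length w) (word_seq w) - birkhoff_sum f (length w) (extend_word w)\<bar> \<le> D0"
      by (rule close) (use w e in \<open>auto simp: word_seq_all_words inf_words_all_words extend_word_nth word_seq_def\<close>)
    moreover have "birkhoff_sum f (length w) (extend_word w) - real (length w) * Fbar
        = birkhoff_sum \<xi> (length w) (extend_word w) + u ((seq_shift ^^ length w) (extend_word w)) - u (extend_word w)"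
      by (rule birkhoff_sum_coboundary[OF e]) (rule dec)
    moreover have "\<bar>u ((seq_shift ^^ length w) (extend_word w))\<bar> \<le> U" "\<bar>u (extend_word w)\<bar> \<le> U"
      using U e by auto
    ultimately show ?thesis unfolding Fw[OF w(1)] by linarith
  qed
  have var: "variance_seq \<mu>\<^sub>0 f \<longlonglongrightarrow> s"
    unfolding s_def by (rule variance_seq_tendsto[OF f xi u mart dec[unfolded Fbar_def]])
  then have s2: "\<sigma>2 = s" unfolding \<sigma>2_def asymptotic_variance_def by (rule limI)
  have "s \<noteq> 0"
  proof
    assume "s = 0"
    have sq: "hoelder \<beta> (\<lambda>x. (\<xi> x)\<^sup>2)"
      using hoelder_mult[OF beta_pos(2) xi xi] by (simp add: power2_eq_square)
    have "\<xi> x = 0" if "x \<in> inf_words" for x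
      using hoelder_nonneg_integral_0[OF sq _ _ that] \<open>s = 0\<close> by (simp add: s_def)
    then have S0: "birkhoff_sum \<xi> n x = 0" if "x \<in> inf_words" for n x
      using birkhoff_sum_bound[OF that, of \<xi> 0 n] by simp
    have "\<bar>F w - Fbar * real (length w)\<bar> \<le> D0 + 2 * \<bar>U\<bar>" if "reduced_word w" for w
    proof (cases "w = []")
      case True
      then show ?thesis using Fw[OF that] K0 beta_less by (simp add: D0_def)
    next
      case False
      then show ?thesis
        using ext[OF that False] S0[OF extend_word_inf_words[OF that False]] by (simp add: mult.commute)
    qed
    then have "bounded ((\<lambda>x. F x - Fbar * real (length x)) ` carrier \<Gamma>)"
      unfolding bounded_iff \<Gamma>_def by (intro exI[of _ "D0 + 2 * \<bar>U\<bar>"]) auto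
    then show False using A3 by blast
  qed
  moreover have "0 \<le> s" by (simp add: s_def)
  ultimately have pos: "0 < s" by simp
  have C: "\<CC> \<in> conjugacy_classes free_group" "\<CC> \<noteq> {[]}"
    using conj_class by (simp_all add: \<Gamma>_def)
  define M where "M = K + \<bar>f (word_seq []) - Fbar\<bar>"
  have M: "\<bar>f y - Fbar\<bar> \<le> M" if "y \<in> all_words" for y
    using hoelder_withD[OF K that, of "word_seq []" 0] by (simp add: word_seq_all_words M_def)
  have "\<bar>F (word_inv w @ g @ w) - real (k + 2 * Suc n) * Fbar - 2 * birkhoff_sum \<xi> n (extend_word w)\<bar>
      \<le> D0 + real k * M + 2 * (D0 + 2 * U + A)"
    if g: "g \<in> of_length \<CC> k" and w: "w \<in> words (Suc n)" and r: "reduced_word (word_inv w @ g @ w)" for g w n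
  proof -
    have lw: "length w = Suc n" "w \<noteq> []" "reduced_word w" using w by (auto simp: words_def)
    have lg: "length g = k" using g by (simp add: of_length_def)
    have rgw: "reduced_word (g @ w)" using r by (auto simp: reduced_append_iff)
    define x where "x = word_inv w @ g @ w"
    have "F x = birkhoff_sum f (Suc n + (k + Suc n)) (word_seq x)"
      using Fw[of x] r lw lg by (simp add: x_def add.assoc)
    also have "\<dots> = birkhoff_sum f (Suc n) (word_seq x) + (birkhoff_sum f k (word_seq (g @ w)) + F w)"
    proof -
      have "drop (Suc n) x = g @ w" "drop k (g @ w) = w"
        using lw(1) lg by (simp_all add: x_def)
      then show ?thesis
        unfolding birkhoff_sum_add[of f "Suc n" "k + Suc n"] birkhoff_sum_add[of f k "Suc n"]
          funpow_shift_word_seq Fw[OF lw(3)] lw(1) by (simp only:)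
    qed
    finally have Fx: "F x = birkhoff_sum f (Suc n) (word_seq x) + birkhoff_sum f k (word_seq (g @ w)) + F w"
      by simp
    have "F w = F (word_inv w)" using A2[of w] lw(3) by (simp add: \<Gamma>_def inv_free_group)
    then have "F w = birkhoff_sum f (Suc n) (word_seq (word_inv w))"
      using Fw[of "word_inv w"] lw by simp
    then have 1: "\<bar>birkhoff_sum f (Suc n) (word_seq x) - F w\<bar> \<le> D0"
      using close[of "word_seq x" "word_seq (word_inv w)" "Suc n"] r lw
      by (simp add: word_seq_all_words x_def word_seq_def nth_append)
    have 2: "\<bar>birkhoff_sum f k (word_seq (g @ w)) - real k * Fbar\<bar> \<le> real k * M"
      by (rule birkhoff_sum_all_words_bound[OF M word_seq_all_words[OF rgw]])
    have 3: "\<bar>(F w - real (Suc n) * Fbar) - birkhoff_sum \<xi> (Suc n) (extend_word w)\<bar> \<le> D0 + 2 * U"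
      using ext[OF lw(3,2)] lw(1) by simp
    \<comment> \<open>the last letter of \<open>w\<close> belongs to the constant tail, so that \<open>n\<close> steps of the operator remain\<close>
    have 4: "\<bar>birkhoff_sum \<xi> (Suc n) (extend_word w) - birkhoff_sum \<xi> n (extend_word w)\<bar> \<le> A"
      using A[OF funpow_shift_inf_words[OF extend_word_inf_words[OF lw(3,2)], of n]]
      by (simp add: birkhoff_sum_def)
    have combine: "\<bar>B + m + W - (b + 2 * a) - 2 * S\<bar> \<le> d + d' + 2 * (d'' + A)"
      if "\<bar>B - W\<bar> \<le> d" "\<bar>m - b\<bar> \<le> d'" "\<bar>(W - a) - S'\<bar> \<le> d''" "\<bar>S' - S\<bar> \<le> A"
      for B m W a b S S' d d' d'' :: real
      using that by (auto simp: abs_le_iff)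
    have 5: "real (k + 2 * Suc n) * Fbar = real k * Fbar + 2 * (real (Suc n) * Fbar)"
      by (simp add: algebra_simps)
    show ?thesis
      unfolding x_def[symmetric] Fx 5 by (rule combine[OF 1 2 3 4])
  qed
  from conjugacy_class_clt[OF C xi mart pos[unfolded s_def] this[unfolded k_def]]
  show ?thesis
    using var pos unfolding s2 by (auto simp: convergent_def k_def s_def)
qed

end
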